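(* The variety $G_2\subset\mathbb{P}^{13}$ does not admit a linear embedding into the Grassmannian $G(3,6)\subset\mathbb{P}^{19}$.
   Context: We work over $\mathbb{C}$. $G_2\subset\mathbb{P}^{13}$ is the $5$-dimensional homogeneous variety that is the closed orbit in the projectivized adjoint representation of the simple Lie group $\mathbb{G}_2$. $G(3,6)\subset\mathbb{P}^{19}$ is the Grassmannian of $3$-dimensional subspaces of a $6$-dimensional vector space in its Plücker embedding. A linear embedding is an embedding induced by a linear embedding of the ambient projective spaces, so that the Plücker hyperplane class pulls back to the hyperplane class. *)

theory Defs
  imports "HOL-Analysis.Analysis"
begin

section \<open>Complexified octonions\<close>

text \<open>
  The complex octonion algebra in Zorn's vector-matrix model.  The octonion \<open>zorn a u v b\<close> with
  \<open>a, b \<in> \<complex>\<close> and \<open>u, v \<in> \<complex>\<^sup>3\<close> is the vector matrix with rows \<open>(a, u)\<close> and \<open>(v, b)\<close>.  Over the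
  complex numbers this is, up to isomorphism, the only octonion algebra.  In the type \<open>8\<close> the
  index \<open>8\<close> is \<open>0\<close>, so the indices \<open>1, \<dots>, 8\<close> are all indices.
\<close>

definition zorn :: "complex \<Rightarrow> complex^3 \<Rightarrow> complex^3 \<Rightarrow> complex \<Rightarrow> complex^8" where
  "zorn a u v b = vector [a, u$1, u$2, u$3, v$1, v$2, v$3, b]"

definition upper_vec :: "complex^8 \<Rightarrow> complex^3" where
  "upper_vec x = vector [x$2, x$3, x$4]"

definition lower_vec :: "complex^8 \<Rightarrow> complex^3" where
  "lower_vec x = vector [x$5, x$6, x$7]"

text \<open>The bilinear dot product (no conjugation) and the cross product on \<open>\<complex>\<^sup>3\<close>.\<close>

definition cdot :: "complex^3 \<Rightarrow> complex^3 \<Rightarrow> complex" where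
  "cdot u v = (\<Sum>i\<in>UNIV. u$i * v$i)"

definition ccross :: "complex^3 \<Rightarrow> complex^3 \<Rightarrow> complex^3" where
  "ccross u v = vector [u$2 * v$3 - u$3 * v$2, u$3 * v$1 - u$1 * v$3, u$1 * v$2 - u$2 * v$1]"

definition oct_mult :: "complex^8 \<Rightarrow> complex^8 \<Rightarrow> complex^8"  (infixl "\<star>" 70) where
  "x \<star> y = zorn
     (x$1 * y$1 + cdot (upper_vec x) (lower_vec y))
     (x$1 *s upper_vec y + y$8 *s upper_vec x - ccross (lower_vec x) (lower_vec y))
     (y$1 *s lower_vec x + x$8 *s lower_vec y + ccross (upper_vec x) (upper_vec y))
     (x$8 * y$8 + cdot (lower_vec x) (upper_vec y))"

text \<open>
  The following facts confirm that this is a unital composition algebra of dimension 8.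
\<close>

definition oct_norm :: "complex^8 \<Rightarrow> complex" where
  "oct_norm x = x$1 * x$8 - cdot (upper_vec x) (lower_vec x)"

lemma vector_8 [simp]:
  "(vector [a,b,c,d,e,f,g,h] :: ('a::zero)^8)$1 = a"
  "(vector [a,b,c,d,e,f,g,h] :: ('a::zero)^8)$2 = b"
  "(vector [a,b,c,d,e,f,g,h] :: ('a::zero)^8)$3 = c"
  "(vector [a,b,c,d,e,f,g,h] :: ('a::zero)^8)$4 = d"
  "(vector [a,b,c,d,e,f,g,h] :: ('a::zero)^8)$5 = e"
  "(vector [a,b,c,d,e,f,g,h] :: ('a::zero)^8)$6 = f"
  "(vector [a,b,c,d,e,f,g,h] :: ('a::zero)^8)$7 = g"
  "(vector [a,b,c,d,e,f,g,h] :: ('a::zero)^8)$8 = h"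
  unfolding vector_def by simp_all

lemma forall_8: "(\<forall>i::8. P i) \<longleftrightarrow> P 1 \<and> P 2 \<and> P 3 \<and> P 4 \<and> P 5 \<and> P 6 \<and> P 7 \<and> P 8"
proof -
  have "i \<in> {1, 2, 3, 4, 5, 6, 7, 8}" for i :: 8
  proof (induct i)
    case (of_int z)
    then have "z \<in> {0, 1, 2, 3, 4, 5, 6, 7}" by auto
    then show ?case by auto
  qed
  then show ?thesis by (metis empty_iff insert_iff)
qed

lemma oct_norm_mult: "oct_norm (x \<star> y) = oct_norm x * oct_norm y"
  by (simp add: oct_norm_def oct_mult_def zorn_def upper_vec_def lower_vec_def cdot_def
      ccross_def sum_3 algebra_simps)

lemma oct_one: "zorn 1 0 0 1 \<star> x = x" "x \<star> zorn 1 0 0 1 = x"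
  by (simp_all add: vec_eq_iff forall_8 oct_mult_def zorn_def upper_vec_def lower_vec_def cdot_def
      ccross_def sum_3)

section \<open>The group \<open>\<bbbG>\<^sub>2\<close> and its adjoint representation\<close>

definition G2_group :: "(complex^8^8) set" where
  "G2_group = {g. invertible g \<and> (\<forall>x y. g *v (x \<star> y) = (g *v x) \<star> (g *v y))}"

text \<open>The Lie algebra of the automorphism group of an algebra is its algebra of derivations.\<close>

definition g2_algebra :: "(complex^8^8) set" where
  "g2_algebra = {D. \<forall>x y. D *v (x \<star> y) = (D *v x) \<star> y + x \<star> (D *v y)}"

definition adjoint_action :: "complex^8^8 \<Rightarrow> complex^8^8 \<Rightarrow> complex^8^8" where
  "adjoint_action g D = g ** D ** matrix_inv g"

section \<open>The adjoint variety\<close>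

text \<open>
  A point of the projective space of a complex vector space is a one-dimensional subspace, as a
  set of vectors.
\<close>

definition matrix_line :: "complex^8^8 \<Rightarrow> (complex^8^8) set" where
  "matrix_line D = range (\<lambda>c. map_matrix ((*) c) D)"

definition proj_g2 :: "(complex^8^8) set set" where
  "proj_g2 = {matrix_line D | D. D \<in> g2_algebra \<and> D \<noteq> 0}"

inductive_set polynomial_functions :: "(complex^8^8 \<Rightarrow> complex) set" where
  const: "(\<lambda>_. c) \<in> polynomial_functions"
| coord: "(\<lambda>D. D$i$j) \<in> polynomial_functions"
| add: "F \<in> polynomial_functions \<Longrightarrow> G \<in> polynomial_functions \<Longrightarrow>
    (\<lambda>D. F D + G D) \<in> polynomial_functions"
| mult: "F \<in> polynomial_functions \<Longrightarrow> G \<in> polynomial_functions \<Longrightarrow>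
    (\<lambda>D. F D * G D) \<in> polynomial_functions"

definition homogeneous :: "(complex^8^8 \<Rightarrow> complex) \<Rightarrow> bool" where
  "homogeneous F \<longleftrightarrow> (\<exists>d::nat. \<forall>c D. F (map_matrix ((*) c) D) = c ^ d * F D)"

definition zariski_closed :: "(complex^8^8) set set \<Rightarrow> bool" where
  "zariski_closed Z \<longleftrightarrow>
     (\<exists>\<F> \<subseteq> {F \<in> polynomial_functions. homogeneous F}.
        Z = {p \<in> proj_g2. \<forall>F\<in>\<F>. \<forall>D\<in>p. F D = 0})"

definition G2_orbit :: "(complex^8^8) set \<Rightarrow> (complex^8^8) set set" where
  "G2_orbit p = {adjoint_action g ` p | g. g \<in> G2_group}"

text \<open>
  There is exactly one closed orbit (the adjoint representation is irreducible), so the points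
  whose orbit is closed are exactly the points of the closed orbit.
\<close>

definition G2_variety :: "(complex^8^8) set set" where
  "G2_variety = {p \<in> proj_g2. zariski_closed (G2_orbit p)}"

section \<open>The Grassmannian \<open>G(3,6)\<close> in its Pluecker embedding\<close>

text \<open>
  Trivectors are alternating tensors: an index \<open>p :: 6^3\<close> is a triple of elements of the
  6-element index type, and the \<open>p\<close>-coordinate of \<open>w\<^sub>1 \<and> w\<^sub>2 \<and> w\<^sub>3\<close>, for the rows \<open>w\<^sub>i\<close> of a
  \<open>3 \<times> 6\<close> matrix, is the minor with columns \<open>p$1, p$2, p$3\<close>.  The alternating tensors form a
  space of dimension 20, with independent coordinates given by the increasing triples.
\<close>

definition trivectors :: "(complex^(6^3)) set" where
  "trivectors = {t. \<forall>\<sigma> p. \<sigma> permutes (UNIV :: 3 set) \<longrightarrow>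
     t $ (\<chi> i. p $ \<sigma> i) = of_int (sign \<sigma>) * t $ p}"

definition wedge :: "complex^6^3 \<Rightarrow> complex^(6^3)" where
  "wedge M = (\<chi> p. det (\<chi> i j. M $ i $ (p $ j)))"

definition grassmannian_3_6 :: "(complex^6) set set" where
  "grassmannian_3_6 = {W. vec.subspace W \<and> vec.dim W = 3}"

text \<open>
  For \<open>W\<close> of dimension 3, all products \<open>w\<^sub>1 \<and> w\<^sub>2 \<and> w\<^sub>3\<close> of vectors of \<open>W\<close> together make up the
  line spanned by the product of a basis of \<open>W\<close>.
\<close>

definition pluecker :: "(complex^6) set \<Rightarrow> (complex^(6^3)) set" where
  "pluecker W = {wedge M | M. rows M \<subseteq> W}"

section \<open>Linear embeddings\<close>

text \<open>
  An injective linear map of \<open>g2_algebra\<close> into the space of trivectors; its values outside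
  \<open>g2_algebra\<close> are irrelevant.  It induces the map \<open>p \<mapsto> f ` p\<close> of projective spaces.
\<close>

definition linear_embedding :: "(complex^8^8 \<Rightarrow> complex^(6^3)) \<Rightarrow> bool" where
  "linear_embedding f \<longleftrightarrow>
     (\<forall>D\<in>g2_algebra. \<forall>E\<in>g2_algebra. f (D + E) = f D + f E) \<and>
     (\<forall>c. \<forall>D\<in>g2_algebra. f (map_matrix ((*) c) D) = c *s f D) \<and>
     inj_on f g2_algebra \<and> f ` g2_algebra \<subseteq> trivectors"

end

theory Submission
  imports Defs
    "HOL-Computational_Algebra.Fundamental_Theorem_Algebra"
    "HOL-Computational_Algebra.Polynomial_Factorial"
    "HOL-Computational_Algebra.Field_as_Ring"
begin

text \<open>
  Let \<open>X\<close> be the closed orbit, \<open>E\<close> a highest root vector, and suppose that \<open>f\<close> maps \<open>X\<close> linearly into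
  the cone of decomposable trivectors of \<open>V = \<complex>\<^sup>6\<close>.  The contradiction comes from the lines of \<open>X\<close>
  through \<open>E\<close> and from the second-order behaviour of \<open>X\<close> along them.

  The points of \<open>X\<close> are the nonzero derivations of square zero
  (\<open>square_zero_der_in_G2_variety\<close>).  That condition is polynomial, so it remains to see that
  such derivations form one orbit: each of them kills an idempotent conjugate to the diagonal one,
  hence is conjugate to an element of \<open>sl\<^sub>3\<close> of square zero, hence to the elementary matrix
  \<open>E13\<close> (\<open>square_zero_der_conjugate\<close>).

  Write \<open>f E = w\<^sub>1 \<and> w\<^sub>2 \<and> w\<^sub>3\<close> and choose coordinates of \<open>V\<close> in which the \<open>w\<^sub>i\<close> are the first three
  basis vectors.  The 20 Pluecker coordinates of \<open>f\<close> become linear forms on the Lie algebra: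
  a scalar \<open>p0\<close> with \<open>p0 E \<noteq> 0\<close>, matrices \<open>A\<close> and \<open>P\<close> of size 3, and a scalar \<open>d\<close>.  On \<open>X\<close> they satisfy
  \<open>p0 P = cof A\<close> and \<open>p0\<^sup>2 d = det A\<close>, and together they are injective on the Lie algebra.

  The lines of \<open>X\<close> through \<open>E\<close> have directions \<open>F(s) = F\<^sub>0 + s F\<^sub>1 + s\<^sup>2 F\<^sub>2 + s\<^sup>3 F\<^sub>3\<close>, a twisted cubic.
  A line in the Grassmannian has a tangent direction of rank one, so \<open>A(F(s))\<close> is a cubic curve of matrices
  of rank one whose four coefficients are linearly independent.  Dividing a column by the gcd of
  its entries factors it as \<open>a(s) b(s)\<^sup>T\<close>.  The degrees \<open>(3,0)\<close> and \<open>(0,3)\<close> are impossible because four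
  vectors of \<open>\<complex>\<^sup>3\<close> are dependent, so up to transposition \<open>b\<close> is linear and \<open>a\<close> is quadratic
  (\<open>rank_one_cubic_factor\<close>).  Since \<open>A\<close> is injective on the span of the \<open>F\<^sub>i\<close>, the quadratic curve \<open>a\<close>
  has no zeros, not even at infinity.

  Take \<open>n \<noteq> 0\<close> orthogonal to both coefficients of \<open>b\<close>.  Then \<open>A(F(s)) n = 0\<close> for all \<open>s\<close>.  Two directions
  \<open>F(s)\<close> and \<open>F(r)\<close> generate a two-parameter family of points of \<open>X\<close> whose mixed second-order term is
  an element \<open>H(s,r)\<close> of degree zero, of degree at most one in \<open>s\<close>.  Comparing coefficients in
  \<open>p0 P = cof A\<close> makes \<open>a(s)\<close> parallel to \<open>A(H(s,r)) n\<close>.  Such a quadratic curve is never parallel to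
  a nonzero linear one (\<open>nonvanishing_quadratic_parallel_linear\<close>), so \<open>A(H(s,r)) n = 0\<close>.  The
  next coefficients propagate this through the whole Lie algebra: \<open>A(x) n = 0\<close> and
  \<open>P(x) (m \<times> n) = 0\<close> for all \<open>x\<close> and \<open>m\<close>.  What is left of \<open>p0, A, P, d\<close> are
  \<open>1 + 6 + 3 + 1 = 11\<close> linear forms, which cannot be injective on a space of dimension 14
  (\<open>no_column_factorisation\<close>).
\<close>

section \<open>Vectors, matrices and numeral index types\<close>

(* Products with transposed matrices are to be expanded into components, not turned into
   products from the left. *)
declare transpose_matrix_vector [simp del]

lemma UNIV_8: "(UNIV :: 8 set) = {1,2,3,4,5,6,7,8}"
  using forall_8[of "\<lambda>i. i \<in> {1,2,3,4,5,6,7,8}"] by auto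

lemma sum_8: "(\<Sum>i\<in>(UNIV :: 8 set). f i) = f 1 + f 2 + f 3 + f 4 + f 5 + f 6 + f 7 + f 8"
  for f :: "8 \<Rightarrow> 'a::comm_monoid_add"
  unfolding UNIV_8 by (simp add: add.assoc)

lemma UNIV_6: "(UNIV :: 6 set) = {1,2,3,4,5,6}"
  by (rule card_eq_UNIV_imp_eq_UNIV[symmetric]) simp_all

lemma forall_6: "(\<forall>i::6. P i) \<longleftrightarrow> P 1 \<and> P 2 \<and> P 3 \<and> P 4 \<and> P 5 \<and> P 6"
proof -
  have "(\<forall>i::6. P i) \<longleftrightarrow> (\<forall>i\<in>UNIV. P i)" by simp
  then show ?thesis unfolding UNIV_6 by simp
qed

lemma vector_11 [simp]:
  "(vector [a1,a2,a3,a4,a5,a6,a7,a8,a9,a10,a11] :: ('a::zero)^11)$1 = a1"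
  "(vector [a1,a2,a3,a4,a5,a6,a7,a8,a9,a10,a11] :: ('a::zero)^11)$2 = a2"
  "(vector [a1,a2,a3,a4,a5,a6,a7,a8,a9,a10,a11] :: ('a::zero)^11)$3 = a3"
  "(vector [a1,a2,a3,a4,a5,a6,a7,a8,a9,a10,a11] :: ('a::zero)^11)$4 = a4"
  "(vector [a1,a2,a3,a4,a5,a6,a7,a8,a9,a10,a11] :: ('a::zero)^11)$5 = a5"
  "(vector [a1,a2,a3,a4,a5,a6,a7,a8,a9,a10,a11] :: ('a::zero)^11)$6 = a6"
  "(vector [a1,a2,a3,a4,a5,a6,a7,a8,a9,a10,a11] :: ('a::zero)^11)$7 = a7"
  "(vector [a1,a2,a3,a4,a5,a6,a7,a8,a9,a10,a11] :: ('a::zero)^11)$8 = a8"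
  "(vector [a1,a2,a3,a4,a5,a6,a7,a8,a9,a10,a11] :: ('a::zero)^11)$9 = a9"
  "(vector [a1,a2,a3,a4,a5,a6,a7,a8,a9,a10,a11] :: ('a::zero)^11)$10 = a10"
  "(vector [a1,a2,a3,a4,a5,a6,a7,a8,a9,a10,a11] :: ('a::zero)^11)$11 = a11"
  unfolding vector_def by simp_all

lemma UNIV_11: "(UNIV :: 11 set) = {1,2,3,4,5,6,7,8,9,10,11}"
  by (rule card_eq_UNIV_imp_eq_UNIV[symmetric]) simp_all

lemma forall_11: "(\<forall>i::11. P i) \<longleftrightarrow> P 1 \<and> P 2 \<and> P 3 \<and> P 4 \<and> P 5 \<and> P 6 \<and> P 7 \<and> P 8 \<and> P 9
   \<and> P 10 \<and> P 11"
proof -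
  have "(\<forall>i::11. P i) \<longleftrightarrow> (\<forall>i\<in>UNIV. P i)" by simp
  then show ?thesis unfolding UNIV_11 by simp
qed

lemma vector_14 [simp]:
  "(vector [a1,a2,a3,a4,a5,a6,a7,a8,a9,a10,a11,a12,a13,a14] :: ('a::zero)^14)$1 = a1"
  "(vector [a1,a2,a3,a4,a5,a6,a7,a8,a9,a10,a11,a12,a13,a14] :: ('a::zero)^14)$2 = a2"
  "(vector [a1,a2,a3,a4,a5,a6,a7,a8,a9,a10,a11,a12,a13,a14] :: ('a::zero)^14)$3 = a3"
  "(vector [a1,a2,a3,a4,a5,a6,a7,a8,a9,a10,a11,a12,a13,a14] :: ('a::zero)^14)$4 = a4"
  "(vector [a1,a2,a3,a4,a5,a6,a7,a8,a9,a10,a11,a12,a13,a14] :: ('a::zero)^14)$5 = a5"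
  "(vector [a1,a2,a3,a4,a5,a6,a7,a8,a9,a10,a11,a12,a13,a14] :: ('a::zero)^14)$6 = a6"
  "(vector [a1,a2,a3,a4,a5,a6,a7,a8,a9,a10,a11,a12,a13,a14] :: ('a::zero)^14)$7 = a7"
  "(vector [a1,a2,a3,a4,a5,a6,a7,a8,a9,a10,a11,a12,a13,a14] :: ('a::zero)^14)$8 = a8"
  "(vector [a1,a2,a3,a4,a5,a6,a7,a8,a9,a10,a11,a12,a13,a14] :: ('a::zero)^14)$9 = a9"
  "(vector [a1,a2,a3,a4,a5,a6,a7,a8,a9,a10,a11,a12,a13,a14] :: ('a::zero)^14)$10 = a10"
  "(vector [a1,a2,a3,a4,a5,a6,a7,a8,a9,a10,a11,a12,a13,a14] :: ('a::zero)^14)$11 = a11"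
  "(vector [a1,a2,a3,a4,a5,a6,a7,a8,a9,a10,a11,a12,a13,a14] :: ('a::zero)^14)$12 = a12"
  "(vector [a1,a2,a3,a4,a5,a6,a7,a8,a9,a10,a11,a12,a13,a14] :: ('a::zero)^14)$13 = a13"
  "(vector [a1,a2,a3,a4,a5,a6,a7,a8,a9,a10,a11,a12,a13,a14] :: ('a::zero)^14)$14 = a14"
  unfolding vector_def by simp_all

lemma UNIV_14: "(UNIV :: 14 set) = {1,2,3,4,5,6,7,8,9,10,11,12,13,14}"
  by (rule card_eq_UNIV_imp_eq_UNIV[symmetric]) simp_all

lemma forall_14: "(\<forall>i::14. P i) \<longleftrightarrow> P 1 \<and> P 2 \<and> P 3 \<and> P 4 \<and> P 5 \<and> P 6 \<and> P 7 \<and> P 8 \<and> P 9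
   \<and> P 10 \<and> P 11 \<and> P 12 \<and> P 13 \<and> P 14"
proof -
  have "(\<forall>i::14. P i) \<longleftrightarrow> (\<forall>i\<in>UNIV. P i)" by simp
  then show ?thesis unfolding UNIV_14 by simp
qed

lemma matrix_eqI: "(\<And>y. A *v y = B *v y) \<Longrightarrow> A = B" for A B :: "complex^8^8"
  by (simp add: matrix_eq)

lemma matrix_inv_both:
  fixes A :: "'a::semiring_1^'n^'m"
  assumes "invertible A"
  shows "A ** matrix_inv A = mat 1" "matrix_inv A ** A = mat 1"
  using someI_ex[OF assms[unfolded invertible_def]] unfolding matrix_inv_def by auto

lemma matrix_inv_unique:
  fixes A :: "'a::semiring_1^'n^'m"
  assumes "A ** B = mat 1" "B ** A = mat 1"
  shows "matrix_inv A = B"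
proof -
  have "invertible A" using assms invertible_def by blast
  then have "matrix_inv A = matrix_inv A ** (A ** B)" using assms by simp
  also have "\<dots> = B" using matrix_inv_both[OF \<open>invertible A\<close>] by (simp add: matrix_mul_assoc)
  finally show ?thesis .
qed

lemma vec_linear_iff: "Vector_Spaces.linear (*s) (*s) f \<longleftrightarrow>
    (\<forall>x y. f (x + y) = f x + f y) \<and> (\<forall>c x. f (c *s x) = c *s f x)"
  for f :: "'a::field^'n \<Rightarrow> 'a^'m"
  by (simp add: Vector_Spaces.linear_iff vec.vector_space_axioms)

text \<open>
  This is used twice as a dimension count: for the four coefficient vectors of a cubic curve in
  \<open>\<complex>\<^sup>3\<close>, and for the 11 linear forms on the Lie algebra.
\<close>

lemma linear_nontrivial_kernel:
  fixes f :: "complex^'n \<Rightarrow> complex^'m"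
  assumes lin: "Vector_Spaces.linear (*s) (*s) f" and card: "CARD('m) < CARD('n)"
  shows "\<exists>x. x \<noteq> 0 \<and> f x = 0"
proof (rule ccontr)
  assume "\<not> ?thesis"
  then have "inj f"
    using vec.linear_inj_iff_eq_0[OF lin] by blast
  then have "vec.dim (f ` UNIV) = vec.dim (UNIV :: (complex^'n) set)"
    using vec.dim_image_eq[OF lin] by (simp add: inj_on_subset)
  moreover have "vec.dim (f ` UNIV) \<le> vec.dim (UNIV :: (complex^'m) set)"
    by (rule vec.dim_subset) auto
  ultimately show False using card unfolding vec_dim_card by linarith
qed

lemma mat3_mult_vec: "(S *v u) $ i = S$i$1 * u$1 + S$i$2 * u$2 + S$i$3 * u$3" for S :: "complex^3^3"
  by (simp add: matrix_vector_mult_def sum_3)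

lemma dual_vector:
  assumes "p \<noteq> 0" shows "\<exists>w. cdot w p = 1"
proof -
  obtain i where "p$i \<noteq> 0" using assms by (auto simp: vec_eq_iff)
  then have "cdot (axis i (1 / p$i)) p = 1"
    by (simp add: cdot_def axis_def if_distrib[where f="\<lambda>x. x * _"] cong: if_cong)
  then show ?thesis by blast
qed

lemmas vec3_simps = vec_eq_iff forall_3 cdot_def ccross_def sum_3 mat3_mult_vec transpose_def vector_3

lemma cramer3: "cdot x (ccross y z) *s u =
   cdot u (ccross y z) *s x + cdot u (ccross z x) *s y + cdot u (ccross x y) *s z"
  by (simp add: vec3_simps, intro conjI; algebra)

lemma ccross_zero_parallel:
  assumes "ccross u v = 0" "u \<noteq> 0" shows "\<exists>c. v = c *s u"
proof -
  obtain w where w: "cdot w u = 1" using dual_vector[OF assms(2)] by blast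
  have "ccross w (ccross u v) = cdot w v *s u - cdot w u *s v"
    by (simp add: vec3_simps, intro conjI; algebra)
  moreover have "ccross w 0 = 0" by (simp add: vec3_simps)
  ultimately have "v = cdot w v *s u" using assms w by simp
  then show ?thesis by blast
qed

section \<open>Derivations of the octonions\<close>

text \<open>
  The Lie algebra \<open>g\<^sub>2\<close> is \<open>sl\<^sub>3\<close> plus the standard representation and its dual.  The matrix \<open>S\<close> acts
  on the upper vectors and by \<open>- S\<^sup>T\<close> on the lower ones, while \<open>p\<close> and \<open>q\<close> are the upper and lower
  parts of the image of the diagonal idempotent \<open>zorn 1 0 0 0\<close>.
\<close>

definition der_map :: "complex^3^3 \<Rightarrow> complex^3 \<Rightarrow> complex^3 \<Rightarrow> complex^8 \<Rightarrow> complex^8" where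
  "der_map S p q y = zorn
     (- cdot q (upper_vec y) - cdot p (lower_vec y))
     ((y$1 - y$8) *s p + S *v upper_vec y + ccross q (lower_vec y))
     ((y$1 - y$8) *s q - transpose S *v lower_vec y + ccross p (upper_vec y))
     (cdot q (upper_vec y) + cdot p (lower_vec y))"

definition der :: "complex^3^3 \<Rightarrow> complex^3 \<Rightarrow> complex^3 \<Rightarrow> complex^8^8" where
  "der S p q = matrix (der_map S p q)"

lemmas oct_simps = zorn_def upper_vec_def lower_vec_def cdot_def ccross_def sum_3
  mat3_mult_vec transpose_def vector_3

lemma der_mult: "der S p q *v y = der_map S p q y"
  unfolding der_def
  by (rule matrix_works)
    (auto simp: vec_linear_iff vec_eq_iff forall_8 der_map_def oct_simps algebra_simps)

lemma zorn_sel: "zorn a u v b $ 1 = a" "zorn a u v b $ 8 = b" "upper_vec (zorn a u v b) = u"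
   "lower_vec (zorn a u v b) = v"
   by (simp_all add: zorn_def upper_vec_def lower_vec_def vec_eq_iff forall_3)

lemma der_in_g2:
  assumes "trace S = 0"
  shows "der S p q \<in> g2_algebra"
proof -
  have S: "S$3$3 = - S$1$1 - S$2$2"
    using assms by (simp add: trace_def sum_3 eq_neg_iff_add_eq_0 algebra_simps)
  show ?thesis
    unfolding g2_algebra_def
    by (intro CollectI allI, simp add: der_mult vec_eq_iff forall_8 der_map_def oct_mult_def oct_simps S, intro conjI; algebra)
qed
text \<open>
  Conversely, the derivation identity on pairs of basis vectors is a system of linear equations
  in the 64 entries.  The products of the diagonal idempotents with each other and with vectors,
  and the products of upper with lower vectors, are enough to express all entries through those of
  \<open>S\<close>, \<open>p\<close> and \<open>q\<close>; the product of two upper vectors gives the trace.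
\<close>

lemma g2_is_der:
  assumes "D \<in> g2_algebra"
  shows "\<exists>S p q. trace S = 0 \<and> D = der S p q"
proof -
  have D: "D *v (x \<star> y) = (D *v x) \<star> y + x \<star> (D *v y)" for x y
    using assms by (auto simp: g2_algebra_def)
  have E: "\<forall>k. (\<Sum>l\<in>UNIV. D$k$l * (axis i 1 \<star> axis j 1)$l) =
     ((\<chi> l. D$l$i) \<star> axis j 1 + axis i 1 \<star> (\<chi> l. D$l$j))$k" for i j
  proof -
    have "D *v axis i 1 = (\<chi> l. D$l$i)" for i
      by (simp add: vec_eq_iff matrix_vector_mult_def axis_def if_distrib cong: if_cong)
    with D[of "axis i 1" "axis j 1"] show ?thesis
      by (simp add: vec_eq_iff) (simp add: matrix_vector_mult_def)
  qed
  note E' = E[unfolded forall_8 oct_mult_def oct_simps sum_8 axis_def, simplified]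
  have R1: "D$1$1 = 0" "D$8$1 = 0"
    using E'[of 1 1, simplified] by (auto simp: eq_neg_iff_add_eq_0 add.commute)
  have R2: "D$8$8 = 0" "D$1$8 = 0"
    using E'[of 8 8, simplified] by (auto simp: eq_neg_iff_add_eq_0 add.commute)
  have R3: "D$2$8 = - D$2$1" "D$3$8 = - D$3$1" "D$4$8 = - D$4$1" "D$5$8 = - D$5$1" "D$6$8 = - D$6$1" "D$7$8 = - D$7$1"
    using E'[of 1 8, simplified] E'[of 8 1, simplified] by (auto simp: eq_neg_iff_add_eq_0 add.commute)
  have R4: "D$1$2 = - D$5$1"
    using E'[of 2 1, simplified] by (auto simp: eq_neg_iff_add_eq_0 add.commute)
  have R5: "D$1$3 = - D$6$1"
    using E'[of 3 1, simplified] by (auto simp: eq_neg_iff_add_eq_0 add.commute)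
  have R6: "D$1$4 = - D$7$1"
    using E'[of 4 1, simplified] by (auto simp: eq_neg_iff_add_eq_0 add.commute)
  have R7: "D$1$5 = - D$2$1"
    using E'[of 8 5, simplified] R3(1-3) by (auto simp: eq_neg_iff_add_eq_0 add.commute)
  have R8: "D$1$6 = - D$3$1"
    using E'[of 8 6, simplified] R3(1-3) by (auto simp: eq_neg_iff_add_eq_0 add.commute)
  have R9: "D$1$7 = - D$4$1"
    using E'[of 8 7, simplified] R3(1-3) by (auto simp: eq_neg_iff_add_eq_0 add.commute)
  have R10: "D$8$5 = D$2$1" "D$7$2 = - D$3$1" "D$6$2 = D$4$1" "D$8$2 = D$5$1" "D$4$5 = - D$6$1" "D$3$5 = D$7$1"
    using E'[of 2 5, simplified] by (auto simp: eq_neg_iff_add_eq_0 add.commute)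
  have R11: "D$7$3 = D$2$1" "D$8$6 = D$3$1" "D$5$3 = - D$4$1" "D$4$6 = D$5$1" "D$8$3 = D$6$1" "D$2$6 = - D$7$1"
    using E'[of 3 6, simplified] by (auto simp: eq_neg_iff_add_eq_0 add.commute)
  have R12: "D$6$4 = - D$2$1" "D$5$4 = D$3$1" "D$8$7 = D$4$1" "D$3$7 = - D$5$1" "D$2$7 = D$6$1" "D$8$4 = D$7$1"
    using E'[of 4 7, simplified] by (auto simp: eq_neg_iff_add_eq_0 add.commute)
  have R13: "D$5$6 = - D$3$2" "D$5$2 = 0" "D$3$6 = 0"
    using E'[of 2 6, simplified] by (auto simp: eq_neg_iff_add_eq_0 add.commute)
  have R14: "D$5$7 = - D$4$2" "D$4$7 = 0"
    using E'[of 2 7, simplified] by (auto simp: eq_neg_iff_add_eq_0 add.commute)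
  have R15: "D$6$5 = - D$2$3" "D$6$3 = 0" "D$2$5 = 0"
    using E'[of 3 5, simplified] by (auto simp: eq_neg_iff_add_eq_0 add.commute)
  have R16: "D$6$7 = - D$4$3"
    using E'[of 3 7, simplified] by (auto simp: eq_neg_iff_add_eq_0 add.commute)
  have R17: "D$7$5 = - D$2$4" "D$7$4 = 0"
    using E'[of 4 5, simplified] by (auto simp: eq_neg_iff_add_eq_0 add.commute)
  have R18: "D$7$6 = - D$3$4"
    using E'[of 4 6, simplified] by (auto simp: eq_neg_iff_add_eq_0 add.commute)
  have R19: "D$5$5 = - D$2$2" "D$6$6 = - D$3$3" "D$7$7 = - D$4$4"
    using E'[of 2 5, simplified] E'[of 3 6, simplified] E'[of 4 7, simplified] R1
    by (simp_all add: eq_neg_iff_add_eq_0 add.commute)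
  have R20: "D$4$4 = - D$2$2 - D$3$3"
  proof -
    have "- D$4$4 = D$2$2 + D$3$3" using E'[of 2 3, simplified] R19 by simp
    then show ?thesis by algebra
  qed
  note R = R1 R2 R3 R4 R5 R6 R7 R8 R9 R10 R11 R12 R13 R14 R15 R16 R17 R18 R19 R20
  define S where "S = (vector [vector [D$2$2, D$2$3, D$2$4], vector [D$3$2, D$3$3, D$3$4],
    vector [D$4$2, D$4$3, D$4$4]] :: complex^3^3)"
  define p where "p = (vector [D$2$1, D$3$1, D$4$1] :: complex^3)"
  define q where "q = (vector [D$5$1, D$6$1, D$7$1] :: complex^3)"
  have "trace S = 0" by (simp add: trace_def S_def sum_3 R)
  moreover have "D = der S p q"
  proof (rule matrix_eqI)
    fix y
    have "D *v y = der_map S p q y"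
      by (simp add: vec_eq_iff forall_8 matrix_vector_mult_def[of D] sum_8 der_map_def oct_simps R S_def p_def q_def algebra_simps)
    then show "D *v y = der S p q *v y" by (simp add: der_mult)
  qed
  ultimately show ?thesis by blast
qed

section \<open>Derivations of square zero\<close>

text \<open>
  The components of the second power on the diagonal idempotent, on upper vectors and on lower
  vectors.
\<close>

lemma der_square_zero_conditions:
  assumes sq: "der S p q ** der S p q = 0"
  shows "cdot p q = 0" "S *v p = 0" "transpose S *v q = 0"
    "S *v (S *v u) = cdot q u *s p"
    "ccross p (S *v u) - transpose S *v ccross p u = (2 * cdot q u) *s q"
    "S *v ccross q v - ccross q (transpose S *v v) = (2 * cdot p v) *s p"
proof -
  have Z: "der_map S p q (der_map S p q y) = 0" for y
    using arg_cong[OF sq, of "\<lambda>A. A *v y"] by (simp add: matrix_vector_mul_assoc[symmetric] der_mult)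
  note simps = vec_eq_iff forall_8 forall_3 der_map_def oct_simps
  let ?e = "der_map S p q (der_map S p q (zorn 1 0 0 0))"
  have "?e $ 8 = 2 * cdot p q" by (simp add: simps algebra_simps)
  then show pq: "cdot p q = 0" using Z by simp
  have "upper_vec ?e = S *v p" by (simp add: simps algebra_simps)
  then show "S *v p = 0" using Z by (simp add: upper_vec_def vec_eq_iff forall_3)
  have "lower_vec ?e = - (transpose S *v q)" by (simp add: simps algebra_simps)
  then show "transpose S *v q = 0" using Z by (simp add: lower_vec_def vec_eq_iff forall_3)
  let ?u = "der_map S p q (der_map S p q (zorn 0 u 0 0))"
  have "upper_vec ?u = S *v (S *v u) - cdot q u *s p - cdot p q *s u"
    by (simp add: simps, intro conjI; algebra)
  then have "S *v (S *v u) - cdot q u *s p = 0" using Z pq by (simp add: upper_vec_def vec_eq_iff forall_3)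
  then show "S *v (S *v u) = cdot q u *s p" by simp
  have "lower_vec ?u = ccross p (S *v u) - transpose S *v ccross p u - (2 * cdot q u) *s q"
    by (simp add: simps)
  then have "ccross p (S *v u) - transpose S *v ccross p u - (2 * cdot q u) *s q = 0"
    using Z by (simp add: lower_vec_def vec_eq_iff forall_3)
  then show "ccross p (S *v u) - transpose S *v ccross p u = (2 * cdot q u) *s q" by simp
  let ?v = "der_map S p q (der_map S p q (zorn 0 0 v 0))"
  have "upper_vec ?v = S *v ccross q v - ccross q (transpose S *v v) - (2 * cdot p v) *s p"
    by (simp add: simps, intro conjI; algebra)
  then have "S *v ccross q v - ccross q (transpose S *v v) - (2 * cdot p v) *s p = 0"
    using Z by (simp add: upper_vec_def vec_eq_iff forall_3)
  then show "S *v ccross q v - ccross q (transpose S *v v) = (2 * cdot p v) *s p" by simp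
qed

text \<open>
  The idempotents \<open>zorn 1 p' 0 0\<close> are images of the diagonal one under the exponentials of
  \<open>der 0 p' 0\<close>, so this is the step that moves a derivation of square zero into \<open>sl\<^sub>3\<close>.  If \<open>w\<close> is dual to
  \<open>p\<close>, then \<open>p' = w \<times> q\<close> satisfies \<open>p \<times> p' = - q\<close> and \<open>q \<cdot> p' = 0\<close>, as required.
  The remaining condition \<open>S p' = - p\<close> follows from the equations for the square.
\<close>

lemma kernel_idempotent:
  assumes sq: "der S p q ** der S p q = 0" and p: "p \<noteq> 0"
  shows "\<exists>p'. der_map S p q (zorn 1 p' 0 0) = 0"
proof -
  note sq' = der_square_zero_conditions[OF sq]
  obtain w where w: "cdot w p = 1" using dual_vector[OF p] by blast
  have "q \<noteq> 0"
  proof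
    assume "q = 0"
    then have "(2 * cdot p w) *s p = 0" using sq'(6)[of w] by (simp add: vec3_simps)
    moreover have "cdot p w = 1" using w by (simp add: cdot_def mult.commute)
    ultimately show False using p by (simp add: vec_eq_iff)
  qed
  then obtain u where u: "cdot u q = 1" using dual_vector by blast
  have u': "cdot q u = 1" using u by (simp add: cdot_def mult.commute)
  define p' where "p' = ccross w q"
  have c1: "ccross p p' = - q"
    using w sq'(1) unfolding p'_def by (simp only: vec3_simps vector_uminus_component, intro conjI; algebra)
  have c2: "cdot q p' = 0" unfolding p'_def by (simp add: vec3_simps algebra_simps)
  have c3: "ccross p (S *v p') = 0"
  proof -
    have "transpose S *v (- q) = 0" using sq'(3) by (simp add: vec.neg)
    then show ?thesis using sq'(5)[of p'] c1 c2 by simp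
  qed
  define \<mu> where "\<mu> = cdot w (S *v p')"
  have c4: "S *v p' = \<mu> *s p"
  proof -
    define z where "z = S *v p'"
    have "ccross p z = 0" using c3 z_def by simp
    moreover have "ccross w (ccross p z) = cdot w z *s p - cdot w p *s z"
      by (simp add: vec3_simps, intro conjI; algebra)
    moreover have "ccross w 0 = 0" by (simp add: vec3_simps)
    ultimately have "z = cdot w z *s p" using w by simp
    then show ?thesis by (simp add: z_def \<mu>_def)
  qed
  (* To find the factor, compare with the image z of a vector u dual to q: it lies in the plane
     orthogonal to q, which is spanned by p and p'. *)
  define z where "z = S *v u"
  have z1: "cdot q z = 0"
  proof -
    have "cdot q z = cdot (transpose S *v q) u" by (simp add: z_def vec3_simps algebra_simps)
    then show ?thesis using sq'(3) by (simp add: cdot_def)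
  qed
  define \<sigma> where "\<sigma> = - cdot z (ccross p' u)"
  define \<beta> where "\<beta> = - cdot z (ccross u p)"
  have d: "cdot p (ccross p' u) = -1"
  proof -
    have "cdot p (ccross p' u) = cdot (ccross p p') u" by (simp add: vec3_simps algebra_simps)
    also have "\<dots> = - cdot q u" unfolding c1 by (simp add: cdot_def sum_negf)
    finally show ?thesis using u' by simp
  qed
  have z2: "z = \<sigma> *s p + \<beta> *s p'"
  proof -
    have "cdot z (ccross p p') = 0" unfolding c1 using z1 by (simp add: cdot_def sum_negf mult.commute)
    then have "- z = - (\<sigma> *s p + \<beta> *s p')" using cramer3[of p p' u z] d
      by (simp add: \<sigma>_def \<beta>_def)
    then show ?thesis by (metis minus_equation_iff)
  qed
  have "\<beta> * \<mu> = 1"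
  proof -
    have "S *v z = \<sigma> *s (S *v p) + \<beta> *s (S *v p')" unfolding z2
      by (simp add: matrix_vector_right_distrib vec.scale)
    then have "S *v z = (\<beta> * \<mu>) *s p" using sq'(2) c4 by simp
    moreover have "S *v z = p" using sq'(4)[of u] u' by (simp add: z_def)
    ultimately have "cdot w ((\<beta> * \<mu>) *s p) = cdot w p" by simp
    moreover have "cdot w ((\<beta> * \<mu>) *s p) = \<beta> * \<mu> * cdot w p" by (simp add: vec3_simps algebra_simps)
    ultimately show ?thesis using w by simp
  qed
  moreover have "\<beta> = -1"
  proof -
    have "ccross p z = \<beta> *s ccross p p'" unfolding z2 by (simp add: vec3_simps algebra_simps)
    then have 1: "ccross p z = - \<beta> *s q" unfolding c1 by (simp add: vec3_simps)
    have "cdot u (ccross p z) - cdot u (transpose S *v ccross p u) = cdot u (2 *s q)"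
      using arg_cong[OF sq'(5)[of u], of "cdot u"] u' unfolding z_def
      by (simp add: cdot_def sum_subtractf right_diff_distrib)
    moreover have "cdot u (transpose S *v ccross p u) = cdot z (ccross p u)"
      unfolding z_def by (simp add: vec3_simps algebra_simps)
    moreover have "cdot z (ccross p u) = \<beta> * cdot p' (ccross p u)"
      unfolding z2 by (simp add: vec3_simps algebra_simps)
    moreover have "cdot p' (ccross p u) = 1" using d by (simp add: vec3_simps, algebra)
    moreover have "cdot u (ccross p z) = - \<beta>" unfolding 1 using u by (simp add: vec3_simps, algebra)
    moreover have "cdot u (2 *s q) = 2" using u by (simp add: vec3_simps, algebra)
    ultimately have s: "- \<beta> - \<beta> = 2" by simp
    have "\<beta> = - ((- \<beta> - \<beta>) / 2)" by simp
    then show ?thesis unfolding s by simp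
  qed
  ultimately have "\<mu> = -1" by algebra
  then have "der_map S p q (zorn 1 p' 0 0) = 0"
    using c1 c2 c4 by (simp add: vec_eq_iff forall_8 der_map_def oct_simps forall_3)
  then show ?thesis by blast
qed

section \<open>The group and its adjoint action\<close>

lemma G2_groupD:
  assumes "g \<in> G2_group"
  shows "invertible g" "g *v (x \<star> y) = (g *v x) \<star> (g *v y)"
    "g ** matrix_inv g = mat 1" "matrix_inv g ** g = mat 1"
    "g *v (matrix_inv g *v x) = x" "matrix_inv g *v (g *v x) = x"
proof -
  show i: "invertible g" and "g *v (x \<star> y) = (g *v x) \<star> (g *v y)" using assms by (auto simp: G2_group_def)
  show 1: "g ** matrix_inv g = mat 1" and 2: "matrix_inv g ** g = mat 1"
    using matrix_inv_both[OF i] by auto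
  show "g *v (matrix_inv g *v x) = x" "matrix_inv g *v (g *v x) = x"
    by (simp_all add: matrix_vector_mul_assoc 1 2)
qed

lemma G2_group_inv:
  assumes g: "g \<in> G2_group" shows "matrix_inv g \<in> G2_group"
proof -
  note G = G2_groupD[OF g]
  have "matrix_inv g *v (x \<star> y) = (matrix_inv g *v x) \<star> (matrix_inv g *v y)" for x y
    by (metis G(2,5,6))
  moreover have "invertible (matrix_inv g)" using G(3,4) invertible_def by blast
  ultimately show ?thesis by (simp add: G2_group_def)
qed

lemma G2_group_mult:
  assumes g: "g \<in> G2_group" and h: "h \<in> G2_group" shows "g ** h \<in> G2_group"
  using G2_groupD(1,2)[OF g] G2_groupD(1,2)[OF h] 
  by (simp add: G2_group_def invertible_mult matrix_vector_mul_assoc[symmetric])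

text \<open>
  Elements of the group will be given as maps in Zorn coordinates, with an explicit inverse.
\<close>

lemma G2_groupI:
  assumes f: "Vector_Spaces.linear (*s) (*s) f" and f': "Vector_Spaces.linear (*s) (*s) f'"
    and inv: "\<And>x. f (f' x) = x" "\<And>x. f' (f x) = x"
    and m: "\<And>x y. f (x \<star> y) = f x \<star> f y"
  shows "matrix f \<in> G2_group"
proof -
  have "matrix f ** matrix f' = mat 1" "matrix f' ** matrix f = mat 1"
    by (rule matrix_eqI, simp add: matrix_vector_mul_assoc[symmetric] matrix_works[OF f] matrix_works[OF f'] inv)+
  then show ?thesis
    using m by (auto simp: G2_group_def invertible_def matrix_works[OF f])
qed

lemma adjoint_in_g2:
  assumes g: "g \<in> G2_group" and D: "D \<in> g2_algebra"
  shows "adjoint_action g D \<in> g2_algebra"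
proof -
  note G = G2_groupD[OF g] 
  note I = G2_groupD(2)[OF G2_group_inv[OF g]]
  have D: "D *v (x \<star> y) = (D *v x) \<star> y + x \<star> (D *v y)" for x y
    using D by (auto simp: g2_algebra_def)
  show ?thesis
    by (simp add: g2_algebra_def adjoint_action_def matrix_vector_mul_assoc[symmetric] I D matrix_vector_right_distrib G)
qed

lemma adjoint_mult:
  assumes g: "g \<in> G2_group" and h: "h \<in> G2_group"
  shows "adjoint_action (g ** h) D = adjoint_action g (adjoint_action h D)"
proof -
  have "matrix_inv (g ** h) = matrix_inv h ** matrix_inv g"
  proof (rule matrix_inv_unique)
    show "g ** h ** (matrix_inv h ** matrix_inv g) = mat 1"
      by (metis G2_groupD(3) g h matrix_mul_assoc matrix_mul_rid)
    show "matrix_inv h ** matrix_inv g ** (g ** h) = mat 1"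
      by (metis G2_groupD(4) g h matrix_mul_assoc matrix_mul_rid)
  qed
  then show ?thesis by (simp add: adjoint_action_def matrix_mul_assoc)
qed

lemma adjoint_intertwine:
  assumes g: "g \<in> G2_group" and "D ** g = g ** E"
  shows "D = adjoint_action g E"
  by (metis G2_groupD(3) adjoint_action_def assms matrix_mul_assoc matrix_mul_rid)

lemma adjoint_sq_zero:
  assumes g: "g \<in> G2_group" and "E ** E = 0"
  shows "adjoint_action g E ** adjoint_action g E = 0"
proof -
  have "adjoint_action g E ** adjoint_action g E = g ** E ** (matrix_inv g ** g) ** E ** matrix_inv g"
    by (simp add: adjoint_action_def matrix_mul_assoc)
  also have "\<dots> = g ** (E ** E) ** matrix_inv g" using G2_groupD(4)[OF g] by (simp add: matrix_mul_assoc)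
  finally show ?thesis using assms(2) by simp
qed

lemma adjoint_nonzero:
  assumes g: "g \<in> G2_group" and "E \<noteq> 0"
  shows "adjoint_action g E \<noteq> 0"
proof
  assume "adjoint_action g E = 0"
  then have "matrix_inv g ** adjoint_action g E ** g = 0" by simp
  moreover have "matrix_inv g ** adjoint_action g E ** g = (matrix_inv g ** g) ** E ** (matrix_inv g ** g)"
    by (simp add: adjoint_action_def matrix_mul_assoc)
  ultimately show False using assms G2_groupD(4)[OF g] by simp
qed

section \<open>The orbit of the derivations of square zero\<close>

text \<open>
  These are the long root vectors.  On the trace-free octonions a long root vector is nilpotent of type
  \<open>(2,2,1,1,1)\<close> and a short one of type \<open>(3,2,2)\<close>, so the vanishing of the square separates the
  minimal orbit from the other nilpotent orbits.
\<close>

definition square_zero_ders :: "(complex^8^8) set" where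
  "square_zero_ders = {D \<in> g2_algebra. D \<noteq> 0 \<and> D ** D = 0}"

text \<open>
  The exponential of the nilpotent derivation \<open>der 0 p 0\<close>; its series stops after the quadratic
  term.
\<close>

definition short_exp :: "complex^3 \<Rightarrow> complex^8 \<Rightarrow> complex^8" where
  "short_exp p y = zorn (y$1 - cdot p (lower_vec y))
     (upper_vec y + (y$1 - y$8 - cdot p (lower_vec y)) *s p)
     (lower_vec y + ccross p (upper_vec y))
     (y$8 + cdot p (lower_vec y))"

lemma short_exp_in_G2: "matrix (short_exp p) \<in> G2_group" and short_exp_linear: "Vector_Spaces.linear (*s) (*s) (short_exp p)"
proof -
  show *: "Vector_Spaces.linear (*s) (*s) (short_exp p)" for p
    by (auto simp: vec_linear_iff vec_eq_iff forall_8 short_exp_def oct_simps algebra_simps)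
  have i: "short_exp p (short_exp (- p) x) = x" for p x
    by (simp add: vec_eq_iff forall_8 short_exp_def oct_simps, (intro conjI)?; algebra)
  have m: "short_exp p (x \<star> y) = short_exp p x \<star> short_exp p y" for x y
    by (simp add: vec_eq_iff forall_8 short_exp_def oct_mult_def oct_simps, intro conjI; algebra)
  show "matrix (short_exp p) \<in> G2_group"
    using G2_groupI[OF * *, of p "- p"] i[of p] i[of "- p"] m by simp
qed

text \<open>
  The matrix with columns \<open>x\<close>, \<open>w\<close>, \<open>z\<close> acts on the upper vectors.  If its determinant is 1, the cross
  products of the columns are the columns of the inverse transpose, which acts on the lower vectors.
\<close>

definition sl3_action :: "complex^3 \<Rightarrow> complex^3 \<Rightarrow> complex^3 \<Rightarrow> complex^8 \<Rightarrow> complex^8" where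
  "sl3_action x w z y = zorn (y$1)
     (upper_vec y $ 1 *s x + upper_vec y $ 2 *s w + upper_vec y $ 3 *s z)
     (lower_vec y $ 1 *s ccross w z + lower_vec y $ 2 *s ccross z x + lower_vec y $ 3 *s ccross x w)
     (y$8)"

definition sl3_inverse :: "complex^3 \<Rightarrow> complex^3 \<Rightarrow> complex^3 \<Rightarrow> complex^8 \<Rightarrow> complex^8" where
  "sl3_inverse x w z y = zorn (y$1)
     (vector [cdot (upper_vec y) (ccross w z), cdot (upper_vec y) (ccross z x), cdot (upper_vec y) (ccross x w)])
     (vector [cdot (lower_vec y) x, cdot (lower_vec y) w, cdot (lower_vec y) z])
     (y$8)"

lemma sl3_action_linear: "Vector_Spaces.linear (*s) (*s) (sl3_action x w z)"
  by (auto simp: vec_linear_iff vec_eq_iff forall_8 sl3_action_def oct_simps algebra_simps)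

lemma sl3_action_in_G2:
  assumes "cdot x (ccross w z) = 1"
  shows "matrix (sl3_action x w z) \<in> G2_group"
proof (rule G2_groupI[OF sl3_action_linear])
  show "Vector_Spaces.linear (*s) (*s) (sl3_inverse x w z)"
    by (auto simp: vec_linear_iff vec_eq_iff forall_8 sl3_inverse_def oct_simps algebra_simps)
  have d: "x$1 * (w$2 * z$3 - w$3 * z$2) + x$2 * (w$3 * z$1 - w$1 * z$3) + x$3 * (w$1 * z$2 - w$2 * z$1) = 1"
    using assms by (simp add: oct_simps)
  show "sl3_action x w z (sl3_inverse x w z y) = y" for y
    using d by (simp add: vec_eq_iff forall_8 sl3_action_def sl3_inverse_def oct_simps, intro conjI; algebra)
  show "sl3_inverse x w z (sl3_action x w z y) = y" for y
    using d by (simp add: vec_eq_iff forall_8 sl3_action_def sl3_inverse_def oct_simps, intro conjI; algebra)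
  show "sl3_action x w z (y \<star> y') = sl3_action x w z y \<star> sl3_action x w z y'" for y y'
  proof -
    define G where "G u = u$1 *s x + u$2 *s w + u$3 *s z" for u :: "complex^3"
    define H where "H v = v$1 *s ccross w z + v$2 *s ccross z x + v$3 *s ccross x w" for v :: "complex^3"
    have T: "sl3_action x w z y = zorn (y$1) (G (upper_vec y)) (H (lower_vec y)) (y$8)" for y
      by (simp add: sl3_action_def G_def H_def)
    have 1: "cdot (G u) (H v) = cdot u v" "cdot (H v) (G u) = cdot v u" for u v
      unfolding G_def H_def using d by (simp add: vec3_simps, algebra)+
    have 2: "ccross (G u) (G u') = H (ccross u u')" for u u'
      unfolding G_def H_def by (simp add: vec3_simps, intro conjI; algebra)
    have 3: "ccross (H v) (H v') = G (ccross v v')" for v v'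
      unfolding G_def H_def by (simp add: vec3_simps, intro conjI; use d in algebra)
    have 4: "G (a *s u + b *s u' - u'') = a *s G u + b *s G u' - G u''"
      "H (a *s u + b *s u' + u'') = a *s H u + b *s H u' + H u''" for a b u u' u''
      by (simp_all add: G_def H_def vec_eq_iff algebra_simps)
    show ?thesis
      unfolding T oct_mult_def zorn_sel by (simp add: 1 2 3 4 zorn_sel)
  qed
qed

definition E13 :: "complex^3^3" where "E13 = vector [vector [0, 0, 1], vector [0, 0, 0], vector [0, 0, 0]]"

lemma der_zero: "der 0 0 0 = 0"
  by (rule matrix_eqI) (simp add: der_mult vec_eq_iff forall_8 der_map_def oct_simps)

lemma der_kills_idempotent:
  assumes "der S p q *v zorn 1 0 0 0 = 0"
  shows "p = 0" "q = 0"
  using assms by (simp_all add: der_mult der_map_def vec_eq_iff forall_8 oct_simps forall_3)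

text \<open>
  A nonzero matrix of size 3 and square zero has rank one, so it has a Jordan basis consisting of
  one chain \<open>z, x\<close> and one further kernel vector \<open>w\<close>; the vector \<open>w\<close> can be scaled to make the determinant 1.
\<close>

lemma nilpotent_sl3_basis:
  fixes S :: "complex^3^3"
  assumes S0: "S \<noteq> 0" and sq: "\<And>u. S *v (S *v u) = 0"
  shows "\<exists>x w z. cdot x (ccross w z) = 1 \<and> S *v x = 0 \<and> S *v w = 0 \<and> S *v z = x"
proof -
  obtain z where z: "S *v z \<noteq> 0" using S0 by (metis matrix_eq matrix_vector_mult_0)
  define x where "x = S *v z"
  have Sx: "S *v x = 0" and x0: "x \<noteq> 0" using sq z by (auto simp: x_def)
  have "ccross z x \<noteq> 0"
  proof
    assume c: "ccross z x = 0"
    obtain v where v: "cdot v x = 1" using dual_vector[OF x0] by blast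
    have "ccross v (ccross z x) = cdot v x *s z - cdot v z *s x"
      by (simp add: vec3_simps, intro conjI; algebra)
    moreover have "ccross v 0 = 0" by (simp add: vec3_simps)
    ultimately have "z = cdot v z *s x" using v c by simp
    then have "S *v z = cdot v z *s (S *v x)" by (metis vec.scale)
    then show False using z Sx by simp
  qed
  then obtain w0 where w0: "cdot w0 (ccross z x) = 1" using dual_vector by blast
  then have d: "cdot x (ccross w0 z) = 1" by (simp add: vec3_simps, algebra)
  define v where "v = S *v w0"
  define a b c where "a = cdot v (ccross w0 z)" and "b = cdot v (ccross z x)" and "c = cdot v (ccross x w0)"
  have v: "v = a *s x + b *s w0 + c *s z"
    using cramer3[of x w0 z v] d by (simp add: a_def b_def c_def)
  have "S *v v = a *s (S *v x) + b *s (S *v w0) + c *s (S *v z)"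
    unfolding v by (simp add: vec.add vec.scale)
  then have e: "b *s v + c *s x = 0" using Sx sq by (simp add: v_def x_def[symmetric])
  have "cdot (b *s v + c *s x) (ccross z x) = b * b"
    by (simp add: b_def) (simp add: vec3_simps algebra_simps)
  then have "b = 0" unfolding e by (simp add: cdot_def)
  then have "c = 0" using e x0 by (auto simp: vec_eq_iff)
  define w where "w = w0 - a *s z"
  have "S *v w = 0"
    using v \<open>b = 0\<close> \<open>c = 0\<close> by (simp add: w_def vec.diff vec.scale v_def[symmetric] x_def[symmetric])
  moreover have "cdot x (ccross w z) = 1"
    using d unfolding w_def by (simp add: vec3_simps, algebra)
  ultimately show ?thesis using Sx x_def by blast
qed

text \<open>
  First \<open>g\<close> moves an idempotent in the kernel to the diagonal one, which puts the derivation into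
  \<open>sl\<^sub>3\<close>.  Then the Jordan basis gives an element of \<open>SL\<^sub>3\<close> that conjugates it to \<open>E13\<close>.  Since the
  conjugated derivation has again the form \<open>der T p q\<close>, it is determined by its values on the
  diagonal idempotent and on the upper vectors.
\<close>

lemma square_zero_der_conjugate:
  assumes "D \<in> square_zero_ders"
  shows "\<exists>g\<in>G2_group. D = adjoint_action g (der E13 0 0)"
proof -
  have D: "D \<in> g2_algebra" "D \<noteq> 0" "D ** D = 0" using assms by (auto simp: square_zero_ders_def)
  have e1: "zorn 1 0 0 0 \<noteq> 0" by (simp add: vec_eq_iff forall_8 zorn_def)
  obtain g where g: "g \<in> G2_group" and ker: "D *v (g *v zorn 1 0 0 0) = 0"
  proof -
    obtain S p q where Dd: "D = der S p q" using g2_is_der[OF D(1)] by blast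
    note sq = D(3)[unfolded Dd]
    obtain p' where p': "der_map S p q (zorn 1 p' 0 0) = 0"
    proof (cases "p = 0")
      case True
      have "q = 0"
      proof (rule ccontr)
        assume "q \<noteq> 0"
        then obtain u where u: "cdot u q = 1" using dual_vector by blast
        have "(2 * cdot q u) *s q = 0"
          using der_square_zero_conditions(5)[OF sq, of u] True by (simp add: vec3_simps)
        moreover have "cdot q u = 1" using u by (simp add: cdot_def mult.commute)
        ultimately show False using \<open>q \<noteq> 0\<close> by (simp add: vec_eq_iff)
      qed
      then show ?thesis
        using that[of 0] True by (simp add: vec_eq_iff forall_8 der_map_def oct_simps)
    next
      case False then show ?thesis using kernel_idempotent[OF sq] that by blast
    qed
    have "matrix (short_exp p') *v zorn 1 0 0 0 = zorn 1 p' 0 0"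
      by (simp add: matrix_works[OF short_exp_linear] short_exp_def vec_eq_iff forall_8 oct_simps)
    then show ?thesis using that[OF short_exp_in_G2[of p']] p' by (simp add: Dd der_mult)
  qed
  define D' where "D' = adjoint_action (matrix_inv g) D"
  have gi: "matrix_inv g \<in> G2_group" using G2_group_inv g by blast
  have ig: "matrix_inv (matrix_inv g) = g" using G2_groupD(3,4)[OF g] matrix_inv_unique by blast
  have DD': "D = adjoint_action g D'"
    unfolding D'_def by (metis G2_groupD(3) adjoint_mult adjoint_action_def g gi ig matrix_mul_lid matrix_mul_rid)
  obtain S p q where D'd: "D' = der S p q"
    using g2_is_der[OF adjoint_in_g2[OF gi D(1)]] unfolding D'_def by blast
  have "D' *v zorn 1 0 0 0 = 0"
    by (simp add: D'_def adjoint_action_def ig matrix_vector_mul_assoc[symmetric] ker)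
  then have "p = 0" "q = 0" using der_kills_idempotent unfolding D'd by blast+
  then have D'S: "D' = der S 0 0" using D'd by simp
  have sq: "der S 0 0 ** der S 0 0 = 0"
    using adjoint_sq_zero[OF gi D(3)] by (simp add: D'_def[symmetric] D'S)
  have "S *v (S *v u) = 0" for u
    using der_square_zero_conditions(4)[OF sq, of u] by (simp add: cdot_def)
  moreover have "S \<noteq> 0"
    using adjoint_nonzero[OF gi D(2)] der_zero by (auto simp: D'_def[symmetric] D'S)
  ultimately obtain x w z where xwz: "cdot x (ccross w z) = 1" "S *v x = 0" "S *v w = 0" "S *v z = x"
    using nilpotent_sl3_basis by blast
  define h where "h = matrix (sl3_action x w z)"
  have h: "h \<in> G2_group" unfolding h_def by (rule sl3_action_in_G2[OF xwz(1)])
  have h_mult: "h *v y = sl3_action x w z y" for y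
    unfolding h_def by (rule matrix_works[OF sl3_action_linear])
  have hi: "matrix_inv h \<in> G2_group" using G2_group_inv h by blast
  have ih: "matrix_inv (matrix_inv h) = h" using G2_groupD(3,4)[OF h] matrix_inv_unique by blast
  define D'' where "D'' = adjoint_action (matrix_inv h) D'"
  obtain T p q where D''d: "D'' = der T p q"
    using g2_is_der[OF adjoint_in_g2[OF hi]] D'_def adjoint_in_g2[OF gi D(1)] unfolding D''_def by metis
  have D'h: "D' ** h = h ** D''"
    by (simp add: D''_def adjoint_action_def ih) (metis G2_groupD(3) h matrix_mul_assoc matrix_mul_lid)
  have "D' *v (h *v zorn 1 0 0 0) = 0"
    by (simp add: h_mult D'S der_mult der_map_def sl3_action_def vec_eq_iff forall_8 oct_simps)
  then have "h *v (D'' *v zorn 1 0 0 0) = 0"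
    using D'h by (metis matrix_vector_mul_assoc)
  then have "D'' *v zorn 1 0 0 0 = 0" using G2_groupD(6)[OF h] by (metis matrix_vector_mult_0_right)
  then have pq: "p = 0" "q = 0" using der_kills_idempotent unfolding D''d by blast+
  have up: "zorn 0 (T *v u) 0 0 = zorn 0 (E13 *v u) 0 0" for u
  proof -
    have "h *v (D'' *v zorn 0 u 0 0) = D' *v (h *v zorn 0 u 0 0)"
      using D'h by (metis matrix_vector_mul_assoc)
    also have "h *v zorn 0 u 0 0 = zorn 0 (u$1 *s x + u$2 *s w + u$3 *s z) 0 0"
      by (simp add: h_mult sl3_action_def vec_eq_iff forall_8 oct_simps)
    also have "D' *v \<dots> = zorn 0 (S *v (u$1 *s x + u$2 *s w + u$3 *s z)) 0 0"
      by (simp add: D'S der_mult der_map_def vec_eq_iff forall_8 oct_simps)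
    also have "S *v (u$1 *s x + u$2 *s w + u$3 *s z) = u$3 *s x"
      by (simp add: vec.add vec.scale xwz)
    also have "zorn 0 (u$3 *s x) 0 0 = h *v zorn 0 (E13 *v u) 0 0"
      by (simp add: h_mult sl3_action_def E13_def vec_eq_iff forall_8 oct_simps)
    finally have "D'' *v zorn 0 u 0 0 = zorn 0 (E13 *v u) 0 0"
      using G2_groupD(6)[OF h] by metis
    moreover have "D'' *v zorn 0 u 0 0 = zorn 0 (T *v u) 0 0"
      by (simp add: D''d pq der_mult der_map_def vec_eq_iff forall_8 oct_simps)
    ultimately show ?thesis by simp
  qed
  have "T *v u = E13 *v u" for u using up[of u] by (metis zorn_sel(3))
  then have "T = E13" by (simp add: matrix_eq)
  then have "D' = adjoint_action h (der E13 0 0)"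
    using adjoint_intertwine[OF h D'h] D''d pq by simp
  then have "D = adjoint_action (g ** h) (der E13 0 0)"
    using DD' adjoint_mult[OF g h] by simp
  then show ?thesis using G2_group_mult[OF g h] by blast
qed

lemma scaled_eq: "map_matrix ((*) c) D = (\<chi> i j. c * D$i$j)" for D :: "complex^8^8"
  by (simp add: map_matrix_def)

lemma scaled_mult_vec: "map_matrix ((*) c) D *v y = c *s (D *v y)" for D :: "complex^8^8"
  by (simp add: scaled_eq vec_eq_iff matrix_vector_mult_def sum_distrib_left mult.assoc)

lemma adjoint_scaled: "adjoint_action g (map_matrix ((*) c) D) = map_matrix ((*) c) (adjoint_action g D)"
  by (rule matrix_eqI) (simp add: adjoint_action_def matrix_vector_mul_assoc[symmetric] scaled_mult_vec vec.scale)

lemma adjoint_matrix_line: "adjoint_action g ` matrix_line D = matrix_line (adjoint_action g D)"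
  by (simp add: matrix_line_def image_image adjoint_scaled)

lemma matrix_line_self: "D \<in> matrix_line D"
proof -
  have "D = map_matrix ((*) 1) D" by (simp add: scaled_eq vec_eq_iff)
  then show ?thesis unfolding matrix_line_def by blast
qed

lemma polynomial_functions_sum:
  assumes "finite I" "\<And>i. i \<in> I \<Longrightarrow> F i \<in> polynomial_functions"
  shows "(\<lambda>D. \<Sum>i\<in>I. F i D) \<in> polynomial_functions"
  using assms
  by (induction I rule: finite_induct)
    (auto intro: polynomial_functions.const[of 0] polynomial_functions.add)

lemma orbit_of_square_zero_der:
  assumes D: "D \<in> square_zero_ders"
  shows "G2_orbit (matrix_line D) = matrix_line ` square_zero_ders"
proof
  show "G2_orbit (matrix_line D) \<subseteq> matrix_line ` square_zero_ders"
    using D adjoint_in_g2 adjoint_nonzero adjoint_sq_zero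
    by (auto simp: G2_orbit_def adjoint_matrix_line square_zero_ders_def)
  show "matrix_line ` square_zero_ders \<subseteq> G2_orbit (matrix_line D)"
  proof
    fix p assume "p \<in> matrix_line ` square_zero_ders"
    then obtain D' where p: "p = matrix_line D'" and D': "D' \<in> square_zero_ders" by blast
    obtain g where g: "g \<in> G2_group" "D = adjoint_action g (der E13 0 0)"
      using square_zero_der_conjugate[OF D] by blast
    obtain h where h: "h \<in> G2_group" "D' = adjoint_action h (der E13 0 0)"
      using square_zero_der_conjugate[OF D'] by blast
    have gi: "matrix_inv g \<in> G2_group" using g G2_group_inv by blast
    have "matrix_inv (matrix_inv g) = g" using G2_groupD(3,4)[OF g(1)] matrix_inv_unique by blast
    then have "adjoint_action (matrix_inv g) D = der E13 0 0"
      unfolding g(2) by (metis G2_groupD(4) adjoint_mult adjoint_action_def g(1) gi matrix_mul_lid matrix_mul_rid matrix_inv_unique)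
    then have "D' = adjoint_action (h ** matrix_inv g) D"
      using adjoint_mult[OF h(1) gi] h(2) by simp
    then show "p \<in> G2_orbit (matrix_line D)"
      using G2_group_mult[OF h(1) gi] by (auto simp: p G2_orbit_def adjoint_matrix_line)
  qed
qed

lemma square_zero_ders_closed: "zariski_closed (matrix_line ` square_zero_ders)"
proof -
  define F where "F i j = (\<lambda>D :: complex^8^8. (D ** D)$i$j)" for i j
  have "F i j \<in> polynomial_functions" for i j
    unfolding F_def matrix_matrix_mult_def
    by (auto intro!: polynomial_functions_sum polynomial_functions.mult polynomial_functions.coord)
  moreover have scale: "F i j (map_matrix ((*) c) D) = c^2 * F i j D" for i j c D
    by (simp add: F_def scaled_eq matrix_matrix_mult_def sum_distrib_left power2_eq_square mult_ac)
  then have "homogeneous (F i j)" for i j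
    unfolding homogeneous_def by blast
  moreover have "matrix_line ` square_zero_ders
      = {p \<in> proj_g2. \<forall>f\<in>range (case_prod F). \<forall>D\<in>p. f D = 0}" (is "_ = ?R")
  proof
    show "matrix_line ` square_zero_ders \<subseteq> ?R"
      by (auto simp: square_zero_ders_def proj_g2_def matrix_line_def scale) (simp add: F_def)
    show "?R \<subseteq> matrix_line ` square_zero_ders"
    proof
      fix p assume p: "p \<in> ?R"
      then obtain D where D: "p = matrix_line D" "D \<in> g2_algebra" "D \<noteq> 0" by (auto simp: proj_g2_def)
      have "F i j D = 0" for i j using p matrix_line_self[of D] D(1) by auto
      then have "D ** D = 0" by (simp add: F_def vec_eq_iff)
      then show "p \<in> matrix_line ` square_zero_ders" using D by (auto simp: square_zero_ders_def)
    qed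
  qed
  ultimately show ?thesis
    unfolding zariski_closed_def by (intro exI[of _ "range (case_prod F)"]) auto
qed

text \<open>
  All these points have the same orbit, and the equations \<open>D ** D = 0\<close> are homogeneous of degree 2.
\<close>

lemma square_zero_der_in_G2_variety:
  assumes "D \<in> square_zero_ders"
  shows "matrix_line D \<in> G2_variety"
  using assms orbit_of_square_zero_der[OF assms] square_zero_ders_closed
  by (auto simp: G2_variety_def proj_g2_def square_zero_ders_def)

section \<open>Coordinates and curves of square-zero derivations\<close>

text \<open>
  The coordinates are ordered by the degree for the coroot \<open>diag(1,0,-1)\<close> of the highest root: coordinate 1
  has degree 2, coordinates 2 to 5 have degree 1, coordinates 6 to 9 (the Cartan part and the middle
  entries of \<open>p\<close> and \<open>q\<close>) have degree 0, coordinates 10 to 13 have degree -1, and coordinate 14 has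
  degree -2.
\<close>

definition g2_elt :: "complex^14 \<Rightarrow> complex^8^8" where
  "g2_elt x = der (vector [vector [x$6, x$2, x$1], vector [x$10, x$7, x$5], vector [x$14, x$13, - x$6 - x$7]])
     (vector [x$3, x$8, x$11]) (vector [x$12, x$9, x$4])"

lemma g2_elt_mult: "g2_elt x *v y = der_map
     (vector [vector [x$6, x$2, x$1], vector [x$10, x$7, x$5], vector [x$14, x$13, - x$6 - x$7]])
     (vector [x$3, x$8, x$11]) (vector [x$12, x$9, x$4]) y"
  by (simp add: g2_elt_def der_mult)

lemma g2_elt_in_g2: "g2_elt x \<in> g2_algebra"
  unfolding g2_elt_def by (rule der_in_g2) (simp add: trace_def sum_3)

lemma g2_elt_add: "g2_elt (x + y) = g2_elt x + g2_elt y"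
  by (rule matrix_eqI)
   (simp add: g2_elt_mult matrix_vector_mult_add_rdistrib vec_eq_iff forall_8 der_map_def oct_simps algebra_simps)

lemma g2_elt_scale: "g2_elt (c *s x) = map_matrix ((*) c) (g2_elt x)"
  by (rule matrix_eqI)
   (simp add: g2_elt_mult scaled_mult_vec vec_eq_iff forall_8 der_map_def oct_simps algebra_simps)

lemma g2_elt_inj: "g2_elt x = g2_elt y \<Longrightarrow> x = y"
proof -
  assume xy: "g2_elt x = g2_elt y"
  note E = arg_cong[OF xy, of "\<lambda>A. A *v z" for z, unfolded g2_elt_mult]
  show ?thesis
    using E[of "zorn 1 0 0 0"] E[of "zorn 0 (axis 1 1) 0 0"] E[of "zorn 0 (axis 2 1) 0 0"] E[of "zorn 0 (axis 3 1) 0 0"]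
    by (simp add: vec_eq_iff forall_14 forall_8 der_map_def oct_simps axis_def)
qed

text \<open>
  Let \<open>Y(r)\<close> be the element of degree -1 with \<open>[Y(r), top_root] = line_dir r\<close>.  Then
  \<open>(s - r)\<^sup>2 levi_elt s r = [Y(r), line_dir s]\<close> and \<open>2 (r - s)\<^sup>3 low_cubic r = [Y(r), [Y(r), line_dir s]]\<close>, and bracketing with \<open>bottom_root\<close> sends
  \<open>top_root\<close> to \<open>levi_bracket\<close> and \<open>line_dir s\<close> to \<open>low_cubic s\<close>.
\<close>

definition top_root :: "complex^14" where "top_root = vector [1,0,0,0,0, 0,0,0,0, 0,0,0,0, 0]"
definition line_dir :: "complex \<Rightarrow> complex^14" where "line_dir s = vector [0,1,s,s^2,s^3, 0,0,0,0, 0,0,0,0, 0]"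
definition levi_elt :: "complex \<Rightarrow> complex \<Rightarrow> complex^14" where "levi_elt s r = vector [0,0,0,0,0, -r,s+r,s*r,1, 0,0,0,0, 0]"
definition levi_bracket :: "complex^14" where "levi_bracket = vector [0,0,0,0,0, -1,0,0,0, 0,0,0,0, 0]"
definition low_cubic :: "complex \<Rightarrow> complex^14" where "low_cubic s = vector [0,0,0,0,0, 0,0,0,0, -(s^3),s,-(s^2),1, 0]"
definition bottom_root :: "complex^14" where "bottom_root = vector [0,0,0,0,0, 0,0,0,0, 0,0,0,0, 1]"

lemma g2_elt_square_zeroI:
  assumes "x \<noteq> 0" and "\<And>y. g2_elt x *v (g2_elt x *v y) = 0"
  shows "g2_elt x \<in> square_zero_ders"
proof -
  have "g2_elt x \<noteq> g2_elt 0" using assms(1) g2_elt_inj by blast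
  moreover have "g2_elt 0 = 0"
    by (rule matrix_eqI) (simp add: g2_elt_mult vec_eq_iff forall_8 der_map_def oct_simps)
  moreover have "g2_elt x ** g2_elt x = 0"
    by (rule matrix_eqI) (simp add: matrix_vector_mul_assoc[symmetric] assms(2))
  ultimately show ?thesis by (simp add: square_zero_ders_def g2_elt_in_g2)
qed

text \<open>
  This is the image of the point \<open>top_root + l line_dir s\<close> of a line through \<open>top_root\<close> under the exponential of
  \<open>m Y(r)\<close>.  For \<open>m = 0\<close> it is the line itself.
\<close>

lemma two_line_point:
  "g2_elt (top_root + l *s line_dir s + m *s line_dir r + (l * m * (s-r)^2) *s levi_elt s r + (l * m^2 * (r-s)^3) *s low_cubic r) \<in> square_zero_ders"
  (is "g2_elt ?x \<in> _")
proof (rule g2_elt_square_zeroI)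
  have "?x $ 1 = 1" by (simp add: top_root_def line_dir_def levi_elt_def low_cubic_def)
  then show "?x \<noteq> 0" by (metis zero_index zero_neq_one)
  show "g2_elt ?x *v (g2_elt ?x *v y) = 0" for y
    by (simp add: top_root_def line_dir_def levi_elt_def low_cubic_def g2_elt_mult vec_eq_iff forall_8 der_map_def oct_simps, intro conjI; algebra)
qed

text \<open>
  The image of \<open>top_root + l line_dir s\<close> under the exponential of \<open>t bottom_root\<close>.
\<close>

lemma opposite_point:
  "g2_elt (top_root + l *s line_dir s + t *s levi_bracket + (l * t) *s low_cubic s + (- (t^2)) *s bottom_root) \<in> square_zero_ders"
  (is "g2_elt ?x \<in> _")
proof (rule g2_elt_square_zeroI)
  have "?x $ 1 = 1" by (simp add: top_root_def line_dir_def levi_bracket_def low_cubic_def bottom_root_def)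
  then show "?x \<noteq> 0" by (metis zero_index zero_neq_one)
  show "g2_elt ?x *v (g2_elt ?x *v y) = 0" for y
    by (simp add: top_root_def line_dir_def levi_bracket_def low_cubic_def bottom_root_def g2_elt_mult vec_eq_iff forall_8 der_map_def oct_simps, intro conjI; algebra)
qed

section \<open>Polynomial identities between vectors\<close>

lemma poly4_zero:
  fixes c0 c1 c2 c3 c4 :: complex
  assumes "finite X" "\<And>x. x \<notin> X \<Longrightarrow> c0 + x * c1 + x^2 * c2 + x^3 * c3 + x^4 * c4 = 0"
  shows "c0 = 0" "c1 = 0" "c2 = 0" "c3 = 0" "c4 = 0"
proof -
  have "- X \<subseteq> {x. poly [:c0,c1,c2,c3,c4:] x = 0}"
    using assms(2) by (auto simp: algebra_simps power2_eq_square power3_eq_cube power4_eq_xxxx)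
  moreover have "infinite (- X)" using assms(1) by (simp add: Compl_eq_Diff_UNIV infinite_UNIV_char_0)
  ultimately have "[:c0,c1,c2,c3,c4:] = 0" using poly_roots_finite finite_subset by blast
  then show "c0 = 0" "c1 = 0" "c2 = 0" "c3 = 0" "c4 = 0" by auto
qed

lemma vec_poly4_zero:
  fixes c0 c1 c2 c3 c4 :: "complex^'n"
  assumes "finite X" "\<And>x. x \<notin> X \<Longrightarrow> c0 + x *s c1 + x^2 *s c2 + x^3 *s c3 + x^4 *s c4 = 0"
  shows "c0 = 0" "c1 = 0" "c2 = 0" "c3 = 0" "c4 = 0"
proof -
  have "c0$i + x * c1$i + x^2 * c2$i + x^3 * c3$i + x^4 * c4$i = 0" if "x \<notin> X" for i x
    using assms(2)[OF that] by (simp add: vec_eq_iff)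
  from poly4_zero[OF assms(1) this] show "c0 = 0" "c1 = 0" "c2 = 0" "c3 = 0" "c4 = 0"
    by (simp_all add: vec_eq_iff)
qed

lemma quadratic_root:
  fixes x y z :: complex
  assumes "y \<noteq> 0" shows "\<exists>s. z + s * x + s^2 * y = 0"
proof -
  have "\<not> constant (poly [:z,x,y:])"
    using assms by (simp add: constant_degree)
  then obtain s where "poly [:z,x,y:] s = 0" using fundamental_theorem_of_algebra by blast
  then show ?thesis by (auto simp: algebra_simps power2_eq_square)
qed

lemma quadratic_curve_not_in_line:
  fixes a0 a1 a2 v :: "complex^3"
  assumes "\<And>s. a0 + s *s a1 + s^2 *s a2 \<noteq> 0" "a2 \<noteq> 0"
    and "a0 = z *s v" "a1 = x *s v" "a2 = y *s v"
  shows False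
proof -
  have "y \<noteq> 0" using assms(2,5) vector_smult_lzero by metis
  then obtain s where "z + s * x + s^2 * y = 0" using quadratic_root by blast
  moreover have "a0 + s *s a1 + s^2 *s a2 = (z + s * x + s^2 * y) *s v"
    by (simp add: assms(3-) vec_eq_iff algebra_simps)
  ultimately have "a0 + s *s a1 + s^2 *s a2 = 0" by simp
  then show False using assms(1) by blast
qed

text \<open>
  If the linear curve were nonzero, then comparing coefficients of the cross product would leave two cases.
  Either all \<open>a\<^sub>i\<close> are multiples of one vector, and the quadratic curve vanishes at a root of a
  quadratic polynomial; or the quadratic curve is the product of the linear curve with a
  linear polynomial, and it vanishes at the root of that one.
\<close>

lemma nonvanishing_quadratic_parallel_linear:
  assumes nv: "\<And>s. a0 + s *s a1 + s^2 *s a2 \<noteq> 0" and a2: "a2 \<noteq> 0" and fin: "finite X"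
    and par: "\<And>s. s \<notin> X \<Longrightarrow> ccross (a0 + s *s a1 + s^2 *s a2) (l0 + s *s l1) = 0"
  shows "l0 = 0" "l1 = 0"
proof -
  have a0: "a0 \<noteq> 0" using nv[of 0] by simp
  have "ccross a0 l0 + s *s (ccross a0 l1 + ccross a1 l0) + s^2 *s (ccross a1 l1 + ccross a2 l0)
     + s^3 *s ccross a2 l1 + s^4 *s 0 = ccross (a0 + s *s a1 + s^2 *s a2) (l0 + s *s l1)" for s
    by (simp add: vec3_simps, intro conjI; algebra)
  then have *: "ccross a0 l0 = 0" "ccross a0 l1 + ccross a1 l0 = 0"
     "ccross a1 l1 + ccross a2 l0 = 0" "ccross a2 l1 = 0"
    using vec_poly4_zero[OF fin, of "ccross a0 l0" "ccross a0 l1 + ccross a1 l0"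
        "ccross a1 l1 + ccross a2 l0" "ccross a2 l1" 0] par by simp_all
  obtain \<rho> where \<rho>: "l0 = \<rho> *s a0" using ccross_zero_parallel[OF *(1) a0] by blast
  obtain \<kappa> where \<kappa>: "l1 = \<kappa> *s a2" using ccross_zero_parallel[OF *(4) a2] by blast
  have "ccross a0 (\<kappa> *s a2 - \<rho> *s a1) = ccross a0 l1 + ccross a1 l0"
    unfolding \<rho> \<kappa> by (simp add: vec3_simps, intro conjI; algebra)
  then obtain x where x: "\<kappa> *s a2 - \<rho> *s a1 = x *s a0" using ccross_zero_parallel[OF _ a0] *(2) by metis
  have "ccross a2 (\<rho> *s a0 - \<kappa> *s a1) = ccross a1 l1 + ccross a2 l0"
    unfolding \<rho> \<kappa> by (simp add: vec3_simps, intro conjI; algebra)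
  then obtain y where y: "\<rho> *s a0 - \<kappa> *s a1 = y *s a2" using ccross_zero_parallel[OF _ a2] *(3) by metis
  have "\<rho> = 0 \<and> \<kappa> = 0"
  proof (rule ccontr)
    assume nz: "\<not> (\<rho> = 0 \<and> \<kappa> = 0)"
    have np: "False" if "a2 = c *s a0" for c
    proof -
      have c: "c \<noteq> 0" using that a2 by auto
      have "\<exists>t. a1 = t *s a0"
      proof (cases "\<rho> = 0")
        case True
        with nz have "\<kappa> \<noteq> 0" by simp
        then have "a1 = (- y * c / \<kappa>) *s a0" using arg_cong[OF y, of "\<lambda>u. - (1 / \<kappa>) *s u"] True that by (simp add: vec_eq_iff)
        then show ?thesis by blast
      next
        case False
        then have "a1 = ((\<kappa> * c - x) / \<rho>) *s a0" using x that by (simp add: vec_eq_iff field_simps)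
        then show ?thesis by blast
      qed
      then obtain t where "a1 = t *s a0" by blast
      then show False using quadratic_curve_not_in_line[of a0 a1 a2 1 a0 t c] nv a2 that by auto
    qed
    consider "\<kappa> = 0" | "\<rho> = 0" "\<kappa> \<noteq> 0" | "\<rho> \<noteq> 0" "\<kappa> \<noteq> 0" using nz by blast
    then show False
    proof cases
      case 1
      then have "\<rho> *s a0 = y *s a2" "\<rho> \<noteq> 0" using y nz by auto
      moreover from this have "y \<noteq> 0" using a0 by auto
      ultimately have "a2 = (\<rho> / y) *s a0" by (simp add: vec_eq_iff field_simps)
      then show False using np by blast
    next
      case 2
      then have "a2 = (x / \<kappa>) *s a0" using x by (simp add: vec_eq_iff field_simps)
      then show False using np by blast
    next
      case 3
      have "\<kappa> *s a2 - x *s a0 = \<rho> *s a1" unfolding x[symmetric] by simp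
      moreover have "a1 = (1/\<rho>) *s (\<rho> *s a1)" using 3 by (simp add: vector_smult_assoc)
      ultimately have a1: "a1 = (1/\<rho>) *s (\<kappa> *s a2 - x *s a0)" by simp
      have e: "(\<rho> * \<rho> + \<kappa> * x) *s a0 = (y * \<rho> + \<kappa> * \<kappa>) *s a2"
      proof -
        have "(\<rho> * \<rho> + \<kappa> * x) *s a0 - (y * \<rho> + \<kappa> * \<kappa>) *s a2
           = \<rho> *s (\<rho> *s a0 - \<kappa> *s a1 - y *s a2) - \<kappa> *s (\<kappa> *s a2 - \<rho> *s a1 - x *s a0)"
          by (simp add: vec_eq_iff algebra_simps)
        then show ?thesis using x y by simp
      qed
      show False
      proof (cases "y * \<rho> + \<kappa> * \<kappa> = 0")
        case False
        then have "a2 = ((\<rho> * \<rho> + \<kappa> * x) / (y * \<rho> + \<kappa> * \<kappa>)) *s a0"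
          using e by (simp add: vec_eq_iff field_simps)
        then show False using np by blast
      next
        case True
        then have "(\<rho> * \<rho> + \<kappa> * x) *s a0 = 0" using e by (metis vector_smult_lzero)
        then have "\<rho> * \<rho> + \<kappa> * x = 0" using a0 by (metis vector_mul_eq_0)
        then have "x = - (\<rho> * \<rho> / \<kappa>)" using 3 by (simp add: field_simps eq_neg_iff_add_eq_0)
        (* Here the quadratic curve is (1 + s \<rho> / \<kappa>) (a0 + (\<kappa> / \<rho>) s a2). *)
        then have "a0 + (- (\<kappa> / \<rho>)) *s a1 + (- (\<kappa> / \<rho>))^2 *s a2 = 0"
          using 3 unfolding a1 by (simp add: vec_eq_iff field_simps power2_eq_square)
        then show False using nv by blast
      qed
    qed
  qed
  then show "l0 = 0" "l1 = 0" using \<rho> \<kappa> by auto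
qed

text \<open>
  The coefficients of the relation \<open>p0 P = cof A\<close> along the points \<open>two_line_point\<close>, applied to \<open>u \<times> n\<close> with
  \<open>A n\<close> vanishing in degrees 2 and 1.  Here \<open>\<pi>\<close>, \<open>\<beta>\<close>, \<open>\<alpha>\<close> stand for \<open>P(x) (u \<times> n)\<close>, \<open>A(x) u\<close> and \<open>A(x) n\<close>.
  The coefficient of \<open>l m\<close> gives the first claim, that of \<open>l\<^sup>2 m\<close> the second, and those of
  \<open>l m\<^sup>2\<close> and \<open>l\<^sup>2 m\<^sup>2\<close> the last two.
\<close>

lemma two_line_expansion:
  fixes e f g h k :: complex and \<pi>H \<pi>R \<beta>F \<beta>G \<beta>H \<beta>R \<alpha>H \<alpha>R :: "complex^3"
  assumes e: "e \<noteq> 0" and rel: "\<And>l m. (e + l*f + m*g + l*m*h + l*m^2*k) *s ((l*m) *s \<pi>H + (l*m^2) *s \<pi>R) =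
    ccross (l *s \<beta>F + m *s \<beta>G + (l*m) *s \<beta>H + (l*m^2) *s \<beta>R) ((l*m) *s \<alpha>H + (l*m^2) *s \<alpha>R)"
  shows "\<pi>H = 0" "ccross \<beta>F \<alpha>H = 0" "\<alpha>H = 0 \<Longrightarrow> \<pi>R = 0" "\<alpha>H = 0 \<Longrightarrow> ccross \<beta>F \<alpha>R = 0"
proof -
  define X where "X m = 0 + m *s (e *s \<pi>H) + m^2 *s (g *s \<pi>H + e *s \<pi>R - ccross \<beta>G \<alpha>H)
     + m^3 *s (g *s \<pi>R - ccross \<beta>G \<alpha>R) + m^4 *s 0" for m
  define Y where "Y m = 0 + m *s (f *s \<pi>H - ccross \<beta>F \<alpha>H)
     + m^2 *s (h *s \<pi>H + f *s \<pi>R - ccross \<beta>F \<alpha>R - ccross \<beta>H \<alpha>H)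
     + m^3 *s (k *s \<pi>H + h *s \<pi>R - ccross \<beta>H \<alpha>R - ccross \<beta>R \<alpha>H)
     + m^4 *s (k *s \<pi>R - ccross \<beta>R \<alpha>R)" for m
  have "l *s X m + l^2 *s Y m =
    (e + l*f + m*g + l*m*h + l*m^2*k) *s ((l*m) *s \<pi>H + (l*m^2) *s \<pi>R) -
    ccross (l *s \<beta>F + m *s \<beta>G + (l*m) *s \<beta>H + (l*m^2) *s \<beta>R) ((l*m) *s \<alpha>H + (l*m^2) *s \<alpha>R)" for l m
    unfolding X_def Y_def by (simp add: vec3_simps, intro conjI; algebra)
  then have XY: "0 + l *s X m + l^2 *s Y m + l^3 *s 0 + l^4 *s 0 = 0" for l m
    using rel[of l m] by simp
  have X: "X m = 0" and Y: "Y m = 0" for m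
    using vec_poly4_zero[of "{}", OF _ XY] by auto
  note X' = vec_poly4_zero[of "{}", OF _ X[unfolded X_def], simplified]
  note Y' = vec_poly4_zero[of "{}", OF _ Y[unfolded Y_def], simplified]
  show 1: "\<pi>H = 0" using X' e by simp
  show 2: "ccross \<beta>F \<alpha>H = 0" using Y' 1 by simp
  have c0: "ccross v 0 = 0" for v by (simp add: vec3_simps)
  show 3: "\<pi>R = 0" if "\<alpha>H = 0" using X' 1 e that by (simp add: c0)
  show "ccross \<beta>F \<alpha>R = 0" if "\<alpha>H = 0" using Y' 1 3[OF that] that by (simp add: c0)
qed

text \<open>
  The same along \<open>opposite_point\<close>, once \<open>A n\<close> and \<open>P (u \<times> n)\<close> are known to vanish in all degrees above -2:
  the relevant coefficients are those of \<open>t\<^sup>2\<close> and \<open>l t\<^sup>2\<close>.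
\<close>

lemma opposite_expansion:
  fixes e f h k z :: complex
  assumes e: "e \<noteq> 0" and rel: "\<And>l t. (e + l*f + t*h + l*t*k - t^2*z) *s (- (t^2) *s \<pi>Z) =
    ccross (l *s \<beta>F + t *s \<beta>h + (l*t) *s \<beta>R - t^2 *s \<beta>Z) (- (t^2) *s \<alpha>Z)"
  shows "\<pi>Z = 0" "ccross \<beta>F \<alpha>Z = 0"
proof -
  have P: "0 + t *s 0 + t^2 *s ((e + l * f) *s \<pi>Z - l *s ccross \<beta>F \<alpha>Z)
     + t^3 *s ((h + l * k) *s \<pi>Z - ccross (\<beta>h + l *s \<beta>R) \<alpha>Z)
     + t^4 *s (ccross \<beta>Z \<alpha>Z - z *s \<pi>Z)
    = ccross (l *s \<beta>F + t *s \<beta>h + (l*t) *s \<beta>R - t^2 *s \<beta>Z) (- (t^2) *s \<alpha>Z)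
     - (e + l*f + t*h + l*t*k - t^2*z) *s (- (t^2) *s \<pi>Z)" for l t
    by (simp add: vec3_simps, intro conjI; algebra)
  have P0: "0 + t *s 0 + t^2 *s ((e + l * f) *s \<pi>Z - l *s ccross \<beta>F \<alpha>Z)
     + t^3 *s ((h + l * k) *s \<pi>Z - ccross (\<beta>h + l *s \<beta>R) \<alpha>Z)
     + t^4 *s (ccross \<beta>Z \<alpha>Z - z *s \<pi>Z) = 0" for l t
    unfolding P rel by simp
  have Q: "(e + l * f) *s \<pi>Z - l *s ccross \<beta>F \<alpha>Z = 0" for l
    using vec_poly4_zero(3)[of "{}", OF _ P0] by simp
  show 1: "\<pi>Z = 0" using Q[of 0] e by simp
  show "ccross \<beta>F \<alpha>Z = 0" using Q[of 1] 1 by simp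
qed

section \<open>Cubic curves of matrices of rank one\<close>

lemma bezout_three:
  fixes x y z :: "complex poly"
  shows "\<exists>g u v w x' y' z'. x = g * x' \<and> y = g * y' \<and> z = g * z' \<and> g = u * x + v * y + w * z"
proof -
  define h where "h = gcd y z"
  define g where "g = gcd x h"
  obtain v w where h: "h = v * y + w * z"
    unfolding h_def by (metis bezout_coefficients_fst_snd)
  obtain u t where g: "g = u * x + t * h"
    unfolding g_def by (metis bezout_coefficients_fst_snd)
  have "g dvd x" "g dvd y" "g dvd z"
    by (auto simp: g_def h_def intro: dvd_trans[OF gcd_dvd2])
  moreover have "g = u * x + (t * v) * y + (t * w) * z"
    by (simp add: g h algebra_simps)
  ultimately show ?thesis unfolding dvd_def by metis
qed

text \<open>
  Take a nonzero column and divide it by the gcd \<open>g\<close> of its entries.  The result is a unimodular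
  vector \<open>a\<close>, and a Bezout combination of the rows gives the row \<open>b\<close>.
\<close>

lemma rank_one_poly_matrix:
  fixes m :: "3 \<Rightarrow> 3 \<Rightarrow> complex poly"
  assumes minors: "\<And>i j k l. m i j * m k l = m i l * m k j"
  shows "\<exists>a b. \<forall>i j. m i j = a i * b j"
proof (cases "\<forall>i j. m i j = 0")
  case True then show ?thesis by (intro exI[of _ "\<lambda>_. 0"]) auto
next
  case False
  then obtain i0 j0 where nz: "m i0 j0 \<noteq> 0" by blast
  obtain g u1 u2 u3 a1 a2 a3 where g: "m 1 j0 = g * a1" "m 2 j0 = g * a2" "m 3 j0 = g * a3"
    "g = u1 * m 1 j0 + u2 * m 2 j0 + u3 * m 3 j0"
    using bezout_three by metis
  define a where "a i = (if i = 1 then a1 else if i = 2 then a2 else a3)" for i :: 3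
  have a: "m i j0 = g * a i" for i
  proof -
    consider "i = 1" | "i = 2" | "i = 3" using exhaust_3 by blast
    then show ?thesis by cases (simp_all add: a_def g(1-3)[symmetric])
  qed
  have g0: "g \<noteq> 0" using nz a by auto
  have "g = u1 * (g * a1) + u2 * (g * a2) + u3 * (g * a3)"
    using g by metis
  then have "g * 1 = g * (u1 * a1 + u2 * a2 + u3 * a3)"
    by (simp add: algebra_simps)
  then have bez: "u1 * a1 + u2 * a2 + u3 * a3 = 1" using g0 by (metis mult_left_cancel)
  have swap: "a i * m k j = a k * m i j" for i j k
  proof -
    have "g * (a i * m k j) = g * (a k * m i j)"
      using minors[of i j0 k j] by (simp add: a mult_ac)
    then show ?thesis using g0 by (metis mult_left_cancel)
  qed
  define b where "b j = u1 * m 1 j + u2 * m 2 j + u3 * m 3 j" for j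
  have "m i j = a i * b j" for i j
  proof -
    have "a i * b j = u1 * (a i * m 1 j) + u2 * (a i * m 2 j) + u3 * (a i * m 3 j)"
      by (simp add: b_def algebra_simps)
    also have "\<dots> = (u1 * a1 + u2 * a2 + u3 * a3) * m i j"
      unfolding swap[of i 1] swap[of i 2] swap[of i 3] by (simp add: a_def algebra_simps)
    finally show ?thesis using bez by simp
  qed
  then show ?thesis by blast
qed

lemma degree_bounds:
  fixes a b :: "3 \<Rightarrow> complex poly"
  assumes "\<And>i j. degree (a i * b j) \<le> 3"
  shows "(\<forall>i. degree (a i) \<le> 2) \<and> (\<forall>j. degree (b j) \<le> 1) \<or> (\<forall>i. degree (a i) \<le> 1) \<and> (\<forall>j. degree (b j) \<le> 2)
    \<or> (\<forall>i. degree (a i) = 0) \<or> (\<forall>j. degree (b j) = 0)"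
proof (cases "(\<forall>i. degree (a i) = 0) \<or> (\<forall>j. degree (b j) = 0)")
  case False
  then obtain i j where ij: "degree (a i) \<noteq> 0" "degree (b j) \<noteq> 0" by blast
  have s: "degree (a k) + degree (b l) \<le> 3" if "degree (a k) \<noteq> 0" "degree (b l) \<noteq> 0" for k l
  proof -
    have "a k \<noteq> 0" "b l \<noteq> 0" using that by auto
    then show ?thesis using assms[of k l] by (simp add: degree_mult_eq)
  qed
  have a2: "degree (a k) \<le> 2" for k using s[of k j] ij by (cases "degree (a k) = 0") auto
  have b2: "degree (b k) \<le> 2" for k using s[of i k] ij by (cases "degree (b k) = 0") auto
  show ?thesis
  proof (cases "\<exists>k. degree (a k) = 2")
    case True
    then obtain k where k: "degree (a k) = 2" by blast
    have "degree (b l) \<le> 1" for l using s[of k l] k by (cases "degree (b l) = 0") auto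
    then show ?thesis using a2 by blast
  next
    case False
    then have "degree (a k) \<le> 1" for k using a2[of k] by (metis Suc_1 le_SucE One_nat_def)
    then show ?thesis using b2 by blast
  qed
qed auto

lemma poly_degree2: "degree p \<le> 2 \<Longrightarrow> poly p s = coeff p 0 + s * coeff p 1 + s^2 * coeff p 2"
  for p :: "complex poly"
proof -
  assume d: "degree p \<le> 2"
  have "p = [:coeff p 0, coeff p 1, coeff p 2:]"
    using d by (intro poly_eqI) (auto simp: coeff_pCons numeral_2_eq_2 split: nat.split intro!: coeff_eq_0)
  then have "poly p s = poly [:coeff p 0, coeff p 1, coeff p 2:] s" by simp
  also have "\<dots> = coeff p 0 + s * coeff p 1 + s^2 * coeff p 2"
    by (simp add: algebra_simps power2_eq_square)
  finally show ?thesis .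
qed

definition cubic_curve :: "complex^3^3 \<Rightarrow> complex^3^3 \<Rightarrow> complex^3^3 \<Rightarrow> complex^3^3 \<Rightarrow> complex \<Rightarrow> complex^3^3" where
  "cubic_curve M0 M1 M2 M3 s = (\<chi> i j. M0$i$j + s * M1$i$j + s^2 * M2$i$j + s^3 * M3$i$j)"

text \<open>
  A curve \<open>a(s) \<beta>\<^sup>T\<close> with constant \<open>\<beta>\<close> has dependent coefficients, because the four coefficients of
  \<open>a\<close> lie in \<open>\<complex>\<^sup>3\<close>.
\<close>

lemma cubic_const_factor:
  fixes m :: "3 \<Rightarrow> 3 \<Rightarrow> complex poly"
  assumes deg: "\<And>i j. degree (m i j) \<le> 3"
    and m: "\<And>i j. m i j = a i * [:\<beta> j:]"
  shows "\<exists>c :: complex^4. c \<noteq> 0 \<and> (\<forall>i j. c$1 * coeff (m i j) 0 + c$2 * coeff (m i j) 1 + c$3 * coeff (m i j) 2 + c$4 * coeff (m i j) 3 = 0)"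
proof -
  let ?f = "\<lambda>c :: complex^4. (\<chi> i. c$1 * coeff (a i) 0 + c$2 * coeff (a i) 1 + c$3 * coeff (a i) 2 + c$4 * coeff (a i) 3) :: complex^3"
  have "Vector_Spaces.linear (*s) (*s) ?f"
    by (auto simp: vec_linear_iff vec_eq_iff algebra_simps)
  then obtain c where c: "c \<noteq> 0" "?f c = 0" using linear_nontrivial_kernel[of ?f] by auto
  have "c$1 * coeff (m i j) 0 + c$2 * coeff (m i j) 1 + c$3 * coeff (m i j) 2 + c$4 * coeff (m i j) 3
     = ?f c $ i * \<beta> j" for i j
    by (simp add: m algebra_simps)
  then have "c$1 * coeff (m i j) 0 + c$2 * coeff (m i j) 1 + c$3 * coeff (m i j) 2 + c$4 * coeff (m i j) 3 = 0" for i j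
    unfolding c(2) by simp
  then show ?thesis using c(1) by blast
qed

text \<open>
  The degrees of the two factors add up to at most 3, and by the independence of the coefficients
  neither factor is constant.  So one of them is at most linear and the other at most quadratic.
\<close>

lemma rank_one_cubic_factor:
  assumes rank: "\<And>s m n. ccross (cubic_curve M0 M1 M2 M3 s *v m) (cubic_curve M0 M1 M2 M3 s *v n) = 0"
    and indep: "\<And>c :: complex^4. (\<And>i j. c$1 * M0$i$j + c$2 * M1$i$j + c$3 * M2$i$j + c$4 * M3$i$j = 0) \<Longrightarrow> c = 0"
  shows "\<exists>a0 a1 a2 b0 b1. (\<forall>s m. cubic_curve M0 M1 M2 M3 s *v m = cdot (b0 + s *s b1) m *s (a0 + s *s a1 + s^2 *s a2))
     \<or> (\<forall>s m. transpose (cubic_curve M0 M1 M2 M3 s) *v m = cdot (b0 + s *s b1) m *s (a0 + s *s a1 + s^2 *s a2))"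
proof -
  define m where "m i j = [:M0$i$j, M1$i$j, M2$i$j, M3$i$j:]" for i j
  have pm: "poly (m i j) s = cubic_curve M0 M1 M2 M3 s $ i $ j" for i j s
    by (simp add: m_def cubic_curve_def algebra_simps power2_eq_square power3_eq_cube)
  have deg: "degree (m i j) \<le> 3" for i j
    by (simp add: m_def)
  have "m i j * m k l = m i l * m k j" for i j k l
  proof -
    have "poly (m i j * m k l) s = poly (m i l * m k j) s" for s
    proof -
      define C where "C = cubic_curve M0 M1 M2 M3 s"
      have col: "(C *v axis q 1) $ p = C$p$q" for p q
        by (simp add: matrix_vector_mult_def axis_def if_distrib cong: if_cong)
      have "ccross (C *v axis j 1) (C *v axis l 1) = 0" unfolding C_def by (rule rank)
      then have r: "C$2$j * C$3$l = C$3$j * C$2$l" "C$3$j * C$1$l = C$1$j * C$3$l" "C$1$j * C$2$l = C$2$j * C$1$l"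
        by (simp_all add: ccross_def vec_eq_iff forall_3 col)
      have "C$i$j * C$k$l = C$i$l * C$k$j"
        using exhaust_3[of i] exhaust_3[of k] r by (auto simp: mult_ac)
      then show ?thesis by (simp add: pm C_def)
    qed
    then show ?thesis by (simp add: poly_eq_poly_eq_iff[symmetric] fun_eq_iff)
  qed
  then obtain a b where ab: "\<And>i j. m i j = a i * b j" using rank_one_poly_matrix by metis
  have entry: "cubic_curve M0 M1 M2 M3 s $ i $ j = poly (a i) s * poly (b j) s" for i j s
    using pm[of i j s] by (simp add: ab)
  have nodep: False if "c \<noteq> 0" "\<And>i j. c$1 * coeff (m i j) 0 + c$2 * coeff (m i j) 1 + c$3 * coeff (m i j) 2 + c$4 * coeff (m i j) 3 = 0"
    for c :: "complex^4"
  proof -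
    have "c = 0" by (rule indep) (use that(2) in \<open>simp add: m_def numeral_2_eq_2 numeral_3_eq_3\<close>)
    then show False using that(1) by simp
  qed
  have nconst: "\<not> (\<forall>j. degree (b j) = 0)"
  proof
    assume "\<forall>j. degree (b j) = 0"
    then have "b j = [:coeff (b j) 0:]" for j by (metis degree_eq_zeroE coeff_pCons_0)
    then have "m i j = a i * [:coeff (b j) 0:]" for i j using ab by metis
    then show False using cubic_const_factor[of m a "\<lambda>j. coeff (b j) 0"] deg nodep by blast
  qed
  have nconst': "\<not> (\<forall>i. degree (a i) = 0)"
  proof
    assume "\<forall>i. degree (a i) = 0"
    then have "a i = [:coeff (a i) 0:]" for i by (metis degree_eq_zeroE coeff_pCons_0)
    then have "m i j = b j * [:coeff (a i) 0:]" for i j using ab mult.commute by metis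
    then show False using cubic_const_factor[of "\<lambda>j i. m i j" b "\<lambda>i. coeff (a i) 0"] deg nodep by blast
  qed
  define va where "va k = (\<chi> i. coeff (a i) k)" for k
  define vb where "vb k = (\<chi> i. coeff (b i) k)" for k
  have "degree (a i * b j) \<le> 3" for i j using deg ab by metis
  then consider "\<forall>i. degree (a i) \<le> 2" "\<forall>j. degree (b j) \<le> 1" | "\<forall>i. degree (a i) \<le> 1" "\<forall>j. degree (b j) \<le> 2"
    using degree_bounds[of a b] nconst nconst' by blast
  then show ?thesis
  proof cases
    case 1
    have pa: "poly (a i) s = (va 0 + s *s va 1 + s^2 *s va 2) $ i" for i s
      using 1 poly_degree2[of "a i" s] by (simp add: va_def)
    have pb: "poly (b i) s = (vb 0 + s *s vb 1) $ i" for i s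
    proof -
      have "coeff (b i) 2 = 0" using 1(2) by (intro coeff_eq_0) (metis less_Suc_eq_le Suc_1)
      moreover have "degree (b i) \<le> 2" using 1(2) by (meson le_trans one_le_numeral)
      ultimately show ?thesis using poly_degree2[of "b i" s] by (simp add: vb_def)
    qed
    have "\<forall>s n. cubic_curve M0 M1 M2 M3 s *v n = cdot (vb 0 + s *s vb 1) n *s (va 0 + s *s va 1 + s^2 *s va 2)"
      by (simp add: vec_eq_iff mat3_mult_vec entry pa pb cdot_def sum_3 algebra_simps)
    then show ?thesis by blast
  next
    case 2
    have pb: "poly (b i) s = (vb 0 + s *s vb 1 + s^2 *s vb 2) $ i" for i s
      using 2 poly_degree2[of "b i" s] by (simp add: vb_def)
    have pa: "poly (a i) s = (va 0 + s *s va 1) $ i" for i s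
    proof -
      have "coeff (a i) 2 = 0" using 2(1) by (intro coeff_eq_0) (metis less_Suc_eq_le Suc_1)
      moreover have "degree (a i) \<le> 2" using 2(1) by (meson le_trans one_le_numeral)
      ultimately show ?thesis using poly_degree2[of "a i" s] by (simp add: va_def)
    qed
    have "\<forall>s n. transpose (cubic_curve M0 M1 M2 M3 s) *v n = cdot (va 0 + s *s va 1) n *s (vb 0 + s *s vb 1 + s^2 *s vb 2)"
      by (simp add: vec_eq_iff mat3_mult_vec transpose_def entry pa pb cdot_def sum_3 algebra_simps)
    then show ?thesis by blast
  qed
qed

section \<open>Linear Pluecker data on the Lie algebra\<close>

definition linear_form :: "(complex^14 \<Rightarrow> complex) \<Rightarrow> bool" where
  "linear_form f \<longleftrightarrow> (\<forall>x y. f (x + y) = f x + f y) \<and> (\<forall>c x. f (c *s x) = c * f x)"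

definition cofactor3 :: "complex^3^3 \<Rightarrow> complex^3^3" where
  "cofactor3 M = vector [
     vector [M$2$2 * M$3$3 - M$2$3 * M$3$2, M$2$3 * M$3$1 - M$2$1 * M$3$3, M$2$1 * M$3$2 - M$2$2 * M$3$1],
     vector [M$3$2 * M$1$3 - M$3$3 * M$1$2, M$3$3 * M$1$1 - M$3$1 * M$1$3, M$3$1 * M$1$2 - M$3$2 * M$1$1],
     vector [M$1$2 * M$2$3 - M$1$3 * M$2$2, M$1$3 * M$2$1 - M$1$1 * M$2$3, M$1$1 * M$2$2 - M$1$2 * M$2$1]]"

lemma cofactor3_ccross: "cofactor3 M *v ccross m n = ccross (M *v m) (M *v n)"
  by (simp add: cofactor3_def vec3_simps, intro conjI; algebra)

lemma cofactor3_transpose: "cofactor3 (transpose M) = transpose (cofactor3 M)"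
  by (simp add: cofactor3_def vec3_simps)

lemma det_as_triple: "det M = cdot (M *v axis 1 1) (ccross (M *v axis 2 1) (M *v axis 3 1))" for M :: "complex^3^3"
  by (simp add: det_3 vec3_simps axis_def algebra_simps)

lemma triple_smult: "cdot (l *s u) (ccross (l *s v) (l *s w)) = l^3 * cdot u (ccross v w)"
  by (simp add: cdot_def ccross_def sum_3 vector_3 algebra_simps power3_eq_cube)

lemma mat3_zeroI: "(\<And>m. M *v m = 0) \<Longrightarrow> M = 0" for M :: "complex^3^3"
  by (simp add: matrix_eq)

lemma mat3_zero_on_ccross: "(\<And>m n. M *v ccross m n = 0) \<Longrightarrow> M = 0" for M :: "complex^3^3"
proof (rule mat3_zeroI)
  fix w
  assume *: "\<And>m n. M *v ccross m n = 0"
  have "w = ccross (axis 2 (w$1)) (axis 3 1) + ccross (axis 3 (w$2)) (axis 1 1) + ccross (axis 1 (w$3)) (axis 2 1)"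
    by (simp add: vec3_simps axis_def)
  then show "M *v w = 0" using * by (metis vec.add add.right_neutral)
qed

text \<open>
  The components of a linear map to trivectors with respect to a splitting \<open>V = W \<oplus> U\<close>, where \<open>W\<close> is
  the 3-space of the point \<open>top_root\<close>: \<open>p0\<close> takes values in \<open>\<Lambda>\<^sup>3 W\<close>, \<open>A\<close> in \<open>\<Lambda>\<^sup>2 W \<otimes> U\<close>, \<open>P\<close> in \<open>W \<otimes> \<Lambda>\<^sup>2 U\<close> and
  \<open>d\<close> in \<open>\<Lambda>\<^sup>3 U\<close>.  The 3-space of a point with \<open>p0 \<noteq> 0\<close> is the graph of the map \<open>W \<rightarrow> U\<close> given by \<open>A / p0\<close>,
  and the relations say that the other components are its minors.
\<close>

locale pluecker_data =
  fixes p0 d :: "complex^14 \<Rightarrow> complex" and A P :: "complex^14 \<Rightarrow> complex^3^3"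
  assumes p0_lin: "linear_form p0" and d_lin: "linear_form d"
    and A_lin: "\<And>i j. linear_form (\<lambda>x. A x $ i $ j)"
    and P_lin: "\<And>i j. linear_form (\<lambda>x. P x $ i $ j)"
    and inj: "\<And>x. p0 x = 0 \<Longrightarrow> A x = 0 \<Longrightarrow> P x = 0 \<Longrightarrow> d x = 0 \<Longrightarrow> x = 0"
    and base: "p0 top_root \<noteq> 0" "A top_root = 0" "P top_root = 0" "d top_root = 0"
    and minors: "\<And>x i j. g2_elt x \<in> square_zero_ders \<Longrightarrow> p0 x * P x $ i $ j = cofactor3 (A x) $ i $ j"
    and determinant: "\<And>x. g2_elt x \<in> square_zero_ders \<Longrightarrow> p0 x ^ 2 * d x = det (A x)"
begin

text \<open>
  Passing to the dual space of \<open>V\<close> exchanges the rows and columns of \<open>A\<close> and \<open>P\<close>.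
\<close>

lemma transpose_data: "pluecker_data p0 d (\<lambda>x. transpose (A x)) (\<lambda>x. transpose (P x))"
proof
  show "x = 0" if "p0 x = 0" "transpose (A x) = 0" "transpose (P x) = 0" "d x = 0" for x
    using that inj[of x] by (simp add: transpose_def vec_eq_iff)
  show "p0 x * transpose (P x) $ i $ j = cofactor3 (transpose (A x)) $ i $ j"
    if "g2_elt x \<in> square_zero_ders" for x i j
    unfolding cofactor3_transpose using minors[OF that] by (simp add: transpose_def)
qed (use p0_lin d_lin A_lin P_lin base determinant in \<open>auto simp: transpose_def vec_eq_iff det_transpose[unfolded transpose_def]\<close>)

lemma p0_simps: "p0 (x + y) = p0 x + p0 y" "p0 (c *s x) = c * p0 x"
  using p0_lin by (auto simp: linear_form_def)

lemma d_simps: "d (x + y) = d x + d y" "d (c *s x) = c * d x"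
  using d_lin by (auto simp: linear_form_def)

lemma A_simps: "A (x + y) *v m = A x *v m + A y *v m" "A (c *s x) *v m = c *s (A x *v m)"
  using A_lin by (simp_all add: linear_form_def vec_eq_iff mat3_mult_vec algebra_simps)

lemma P_simps: "P (x + y) *v m = P x *v m + P y *v m" "P (c *s x) *v m = c *s (P x *v m)"
  using P_lin by (simp_all add: linear_form_def vec_eq_iff mat3_mult_vec algebra_simps)

lemma diff_simps: "p0 (x - y) = p0 x - p0 y" "d (x - y) = d x - d y"
  "A (x - y) *v m = A x *v m - A y *v m" "P (x - y) *v m = P x *v m - P y *v m"
proof -
  have "x - y = x + (-1) *s y" by (simp add: vec_eq_iff)
  then show "p0 (x - y) = p0 x - p0 y" "d (x - y) = d x - d y"
    "A (x - y) *v m = A x *v m - A y *v m" "P (x - y) *v m = P x *v m - P y *v m"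
    by (simp_all only: p0_simps d_simps A_simps P_simps) simp_all
qed

lemmas lin_simps = p0_simps d_simps A_simps P_simps diff_simps

lemma minors_ccross:
  assumes "g2_elt x \<in> square_zero_ders"
  shows "p0 x *s (P x *v ccross m n) = ccross (A x *v m) (A x *v n)"
proof -
  have "p0 x *s (P x *v ccross m n) = cofactor3 (A x) *v ccross m n"
    by (simp add: vec_eq_iff mat3_mult_vec minors[OF assms, symmetric] algebra_simps)
  then show ?thesis by (simp add: cofactor3_ccross)
qed

text \<open>
  Along the line \<open>top_root + l line_dir s\<close> the matrix \<open>A\<close> is linear in \<open>l\<close> and its minors are quadratic, whereas
  \<open>p0 P\<close> starts with the linear term \<open>l p0(top_root) P(line_dir s)\<close>.
\<close>

lemma on_lines: "P (line_dir s) = 0" "ccross (A (line_dir s) *v m) (A (line_dir s) *v n) = 0" "d (line_dir s) = 0"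
proof -
  have X: "g2_elt (top_root + l *s line_dir s) \<in> square_zero_ders" for l
    using two_line_point[of l s 0 0] by simp
  have *: "P (line_dir s) *v ccross m n = 0 \<and> ccross (A (line_dir s) *v m) (A (line_dir s) *v n) = 0" for m n
  proof -
    have "0 + l *s (p0 top_root *s (P (line_dir s) *v ccross m n)) +
      l^2 *s (p0 (line_dir s) *s (P (line_dir s) *v ccross m n) - ccross (A (line_dir s) *v m) (A (line_dir s) *v n)) + l^3 *s 0 + l^4 *s 0 = 0" for l
    proof -
      have "(p0 top_root + l * p0 (line_dir s)) *s (l *s (P (line_dir s) *v ccross m n)) = ccross (l *s (A (line_dir s) *v m)) (l *s (A (line_dir s) *v n))"
        using minors_ccross[OF X[of l], of m n] by (simp add: lin_simps base)
      moreover have "ccross (l *s u) (l *s v) = l^2 *s ccross u v" for u v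
        by (simp add: vec3_simps algebra_simps power2_eq_square)
      ultimately show ?thesis by (simp add: vec_eq_iff algebra_simps power2_eq_square)
    qed
    from vec_poly4_zero(2,3)[of "{}", OF _ this] show ?thesis using base by simp
  qed
  show "P (line_dir s) = 0" using * by (intro mat3_zero_on_ccross) auto
  show c: "ccross (A (line_dir s) *v m) (A (line_dir s) *v n) = 0" for m n using * by auto
  have "0 + l * (p0 top_root ^ 2 * d (line_dir s)) + l^2 * (2 * p0 top_root * p0 (line_dir s) * d (line_dir s)) + l^3 * (p0 (line_dir s) ^ 2 * d (line_dir s)) + l^4 * 0 = 0" for l
  proof -
    have "(p0 top_root + l * p0 (line_dir s))^2 * (l * d (line_dir s)) = det (A (top_root + l *s line_dir s))"
      using determinant[OF X[of l]] by (simp add: lin_simps base)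
    also have "\<dots> = cdot (l *s (A (line_dir s) *v axis 1 1)) (ccross (l *s (A (line_dir s) *v axis 2 1)) (l *s (A (line_dir s) *v axis 3 1)))"
      by (simp add: det_as_triple lin_simps base)
    also have "\<dots> = l^3 * cdot (A (line_dir s) *v axis 1 1) (ccross (A (line_dir s) *v axis 2 1) (A (line_dir s) *v axis 3 1))"
      by (rule triple_smult)
    also have "\<dots> = 0" unfolding c by (simp add: cdot_def)
    finally show ?thesis by (simp add: algebra_simps power2_eq_square power3_eq_cube)
  qed
  from poly4_zero(2)[of "{}", OF _ this] show "d (line_dir s) = 0" using base by simp
qed

lemma only_base_point: "A x = 0 \<Longrightarrow> P x = 0 \<Longrightarrow> d x = 0 \<Longrightarrow> \<exists>k. x = k *s top_root"
proof -
  assume x: "A x = 0" "P x = 0" "d x = 0"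
  define k where "k = - (p0 x / p0 top_root)"
  let ?y = "x + k *s top_root"
  have "p0 ?y = 0" unfolding p0_simps using base by (simp add: k_def)
  moreover have "d ?y = 0" unfolding d_simps using x base by simp
  moreover have "A ?y = 0" "P ?y = 0" using x base by (auto intro!: mat3_zeroI simp: lin_simps)
  ultimately have "?y = 0" using inj by blast
  then have "x = (- k) *s top_root" by (simp add: vec_eq_iff eq_neg_iff_add_eq_0)
  then show ?thesis by blast
qed

lemma line_dir_expand: "line_dir s = axis 2 1 + s *s axis 3 1 + s^2 *s axis 4 1 + s^3 *s axis 5 1"
  by (simp add: vec_eq_iff forall_14 line_dir_def axis_def)

lemma on_line_basis: "P (axis 2 1) = 0" "P (axis 3 1) = 0" "P (axis 4 1) = 0" "P (axis 5 1) = 0"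
  "d (axis 2 1) = 0" "d (axis 3 1) = 0" "d (axis 4 1) = 0" "d (axis 5 1) = 0"
proof -
  have "P (axis 2 1) *v m + s *s (P (axis 3 1) *v m) + s^2 *s (P (axis 4 1) *v m) + s^3 *s (P (axis 5 1) *v m) + s^4 *s 0 = 0" for s m
    using on_lines(1)[of s] arg_cong[OF line_dir_expand[of s], of "\<lambda>x. P x *v m"] by (simp add: lin_simps)
  note this = vec_poly4_zero[of "{}", OF _ this]
  then show "P (axis 2 1) = 0" "P (axis 3 1) = 0" "P (axis 4 1) = 0" "P (axis 5 1) = 0"
    by (auto intro: mat3_zeroI)
  have "d (axis 2 1) + s * d (axis 3 1) + s^2 * d (axis 4 1) + s^3 * d (axis 5 1) + s^4 * 0 = 0" for s
    using on_lines(3)[of s] arg_cong[OF line_dir_expand[of s], of d] by (simp add: lin_simps)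
  from poly4_zero[of "{}", OF _ this]
  show "d (axis 2 1) = 0" "d (axis 3 1) = 0" "d (axis 4 1) = 0" "d (axis 5 1) = 0" by auto
qed

lemma A_line_cubic: "A (line_dir s) = cubic_curve (A (axis 2 1)) (A (axis 3 1)) (A (axis 4 1)) (A (axis 5 1)) s"
  using A_lin by (simp add: line_dir_expand vec_eq_iff linear_form_def cubic_curve_def)

text \<open>
  In degree 1 the components \<open>P\<close> and \<open>d\<close> vanish, so an element of degree 1 in the kernel of \<open>A\<close>
  is a multiple of \<open>top_root\<close> by injectivity, hence zero.
\<close>

lemma A_injective_on_lines:
  assumes "\<And>i j. c$1 * A (axis 2 1) $i$j + c$2 * A (axis 3 1) $i$j + c$3 * A (axis 4 1) $i$j + c$4 * A (axis 5 1) $i$j = 0"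
  shows "c = (0 :: complex^4)"
proof -
  let ?x = "c$1 *s axis 2 1 + c$2 *s axis 3 1 + c$3 *s axis 4 1 + c$4 *s axis 5 1 :: complex^14"
  have "A ?x = 0" using assms A_lin by (simp add: vec_eq_iff linear_form_def)
  moreover have "P ?x = 0" by (rule mat3_zeroI) (simp add: lin_simps on_line_basis)
  moreover have "d ?x = 0" by (simp add: lin_simps on_line_basis)
  ultimately obtain k where x: "?x = k *s top_root" using only_base_point by blast
  have "?x $ 2 = 0 \<and> ?x $ 3 = 0 \<and> ?x $ 4 = 0 \<and> ?x $ 5 = 0" unfolding x by (simp add: top_root_def)
  then show ?thesis by (simp add: axis_def vec_eq_iff forall_4)
qed

lemma levi_elt_expand: "levi_elt s r = (axis 9 1 + r *s (axis 7 1 + (-1) *s axis 6 1)) + s *s (axis 7 1 + r *s axis 8 1)"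
  by (simp add: vec_eq_iff forall_14 levi_elt_def axis_def)

lemma low_cubic_expand: "low_cubic r = axis 13 1 + r *s axis 11 1 + r^2 *s ((-1) *s axis 12 1) + r^3 *s ((-1) *s axis 10 1)"
  by (simp add: vec_eq_iff forall_14 low_cubic_def axis_def)

lemma vec14_expand: "x = x$1 *s top_root + x$2 *s axis 2 1 + x$3 *s axis 3 1 + x$4 *s axis 4 1 + x$5 *s axis 5 1
   + x$6 *s axis 6 1 + x$7 *s axis 7 1 + x$8 *s axis 8 1 + x$9 *s axis 9 1 + x$10 *s axis 10 1
   + x$11 *s axis 11 1 + x$12 *s axis 12 1 + x$13 *s axis 13 1 + x$14 *s bottom_root" for x :: "complex^14"
  by (simp add: vec_eq_iff forall_14 top_root_def bottom_root_def axis_def)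

text \<open>
  This is the core of the proof.  The vector \<open>n\<close> is chosen such that \<open>A n\<close> vanishes on all directions of
  lines; the vanishing of \<open>A n\<close> and of \<open>P (m \<times> n)\<close> is then pushed down through the degrees 0, -1 and -2.
  Geometrically it means that the 3-spaces of all points lie in a fixed hyperplane, so that only the
  10-dimensional \<open>\<Lambda>\<^sup>3 \<complex>\<^sup>5\<close> would be available for a space of dimension 14.
\<close>

lemma no_column_factorisation:
  assumes fac: "\<And>s m. A (line_dir s) *v m = cdot (b0 + s *s b1) m *s (a0 + s *s a1 + s^2 *s a2)"
  shows False
proof -
  define a where "a s = a0 + s *s a1 + s^2 *s a2" for s
  let ?fn = "\<lambda>n :: complex^3. vector [cdot b0 n, cdot b1 n] :: complex^2"
  have "Vector_Spaces.linear (*s) (*s) ?fn"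
    by (auto simp: vec_linear_iff vec_eq_iff forall_2 cdot_def sum_3 algebra_simps)
  then obtain n where n: "n \<noteq> 0" "?fn n = 0" using linear_nontrivial_kernel[of ?fn] by auto
  then have bn: "cdot b0 n = 0" "cdot b1 n = 0" by (auto simp: vec_eq_iff forall_2)
  then have "cdot (b0 + s *s b1) n = 0" for s
    by (simp add: cdot_def sum_3 algebra_simps) algebra
  then have AFn: "A (line_dir s) *v n = 0" for s by (simp add: fac)

  have AF: "A (line_dir s) \<noteq> 0" for s
  proof
    assume "A (line_dir s) = 0"
    then obtain k where x: "line_dir s = k *s top_root" using only_base_point on_lines by blast
    have "line_dir s $ 2 = 0" unfolding x by (simp add: top_root_def)
    then show False by (simp add: line_dir_def)
  qed
  have a_nz: "a s \<noteq> 0" for s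
  proof
    assume "a s = 0"
    then have "A (line_dir s) = 0" by (intro mat3_zeroI) (simp add: fac a_def)
    then show False using AF by blast
  qed
  have b_nz: "\<exists>m. cdot (b0 + s *s b1) m = 1" for s
  proof -
    have "b0 + s *s b1 \<noteq> 0"
    proof
      assume "b0 + s *s b1 = 0"
      then have "A (line_dir s) = 0" by (intro mat3_zeroI) (simp add: fac cdot_def)
      then show False using AF by blast
    qed
    then obtain m where "cdot m (b0 + s *s b1) = 1" using dual_vector by blast
    moreover have "cdot (b0 + s *s b1) m = cdot m (b0 + s *s b1)" by (simp add: cdot_def mult.commute)
    ultimately show ?thesis by metis
  qed
  have a2_nz: "a2 \<noteq> 0"
  proof
    assume a2: "a2 = 0"
    have "A (axis 5 1) *v m = 0" for m
    proof -
      have "(A (axis 2 1) *v m - cdot b0 m *s a0) + s *s (A (axis 3 1) *v m - cdot b0 m *s a1 - cdot b1 m *s a0)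
        + s^2 *s (A (axis 4 1) *v m - cdot b1 m *s a1) + s^3 *s (A (axis 5 1) *v m) + s^4 *s 0 = 0" for s
      proof -
        have "A (axis 2 1) *v m + s *s (A (axis 3 1) *v m) + s^2 *s (A (axis 4 1) *v m) + s^3 *s (A (axis 5 1) *v m)
          = cdot (b0 + s *s b1) m *s (a0 + s *s a1)"
          using fac[of s m] by (simp add: line_dir_expand lin_simps a2)
        moreover have "cdot (b0 + s *s b1) m = cdot b0 m + s * cdot b1 m"
          by (simp add: cdot_def sum_3 algebra_simps)
        ultimately show ?thesis by (simp add: vec_eq_iff algebra_simps power2_eq_square)
      qed
      from vec_poly4_zero(4)[of "{}", OF _ this] show ?thesis by simp
    qed
    then have "A (axis 5 1) = 0" by (rule mat3_zeroI)
    then obtain k where x: "axis 5 1 = k *s top_root" using only_base_point on_line_basis by blast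
    have "(axis 5 1 :: complex^14) $ 5 = 0" unfolding x by (simp add: top_root_def)
    then show False by simp
  qed
  have parallel_a: "v = 0" if "\<And>s. s \<noteq> r \<Longrightarrow> ccross (a s) v = 0" for r v
    using nonvanishing_quadratic_parallel_linear(1)[of a0 a1 a2 "{r}" v 0] that a_nz a2_nz by (auto simp: a_def)
  have from_AF: "ccross (a s) v = 0" if "\<And>m. ccross (A (line_dir s) *v m) v = 0" for s v
  proof -
    obtain m where "cdot (b0 + s *s b1) m = 1" using b_nz by blast
    then have "A (line_dir s) *v m = a s" by (simp add: fac a_def)
    then show ?thesis using that by metis
  qed

  (* Degree 0: the points obtained from two lines. *)
  let ?h = "\<lambda>s r. ((s - r)^2) *s levi_elt s r" and ?k = "\<lambda>s r. ((r - s)^3) *s low_cubic r"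
  have so: "P (?h s r) *v ccross m n = 0" "ccross (A (line_dir s) *v m) (A (?h s r) *v n) = 0"
    "A (?h s r) *v n = 0 \<Longrightarrow> P (?k s r) *v ccross m n = 0"
    "A (?h s r) *v n = 0 \<Longrightarrow> ccross (A (line_dir s) *v m) (A (?k s r) *v n) = 0" for s r m
  proof -
    have "(p0 top_root + l * p0 (line_dir s) + \<mu> * p0 (line_dir r) + l*\<mu> * p0 (?h s r) + l*\<mu>^2 * p0 (?k s r)) *s
        ((l*\<mu>) *s (P (?h s r) *v ccross m n) + (l*\<mu>^2) *s (P (?k s r) *v ccross m n)) =
        ccross (l *s (A (line_dir s) *v m) + \<mu> *s (A (line_dir r) *v m) + (l*\<mu>) *s (A (?h s r) *v m) + (l*\<mu>^2) *s (A (?k s r) *v m))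
          ((l*\<mu>) *s (A (?h s r) *v n) + (l*\<mu>^2) *s (A (?k s r) *v n))" for l \<mu>
      using minors_ccross[OF two_line_point[of l s \<mu> r], of m n]
      by (simp add: lin_simps base AFn on_lines(1) mult_ac)
    note r = two_line_expansion[OF base(1) this]
    show "P (?h s r) *v ccross m n = 0" "ccross (A (line_dir s) *v m) (A (?h s r) *v n) = 0"
      "A (?h s r) *v n = 0 \<Longrightarrow> P (?k s r) *v ccross m n = 0"
      "A (?h s r) *v n = 0 \<Longrightarrow> ccross (A (line_dir s) *v m) (A (?k s r) *v n) = 0"
      using r by blast+
  qed
  (* For s = r the relation is empty, so this value has to be excepted. *)
  have PH: "P (levi_elt s r) *v ccross m n = 0" if "s \<noteq> r" for s r m
    using so(1)[of s r m] that by (simp add: lin_simps)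
  have ccross_smult: "ccross u (c *s v) = c *s ccross u v" for u v c
    by (simp add: vec3_simps algebra_simps)
  have aH: "ccross (a s) (A (levi_elt s r) *v n) = 0" if "s \<noteq> r" for s r
    using so(2)[of s _ r] that by (intro from_AF) (simp add: lin_simps ccross_smult)
  (* For fixed r the vector A(H(s,r)) n depends on s by a polynomial of degree at most 1. *)
  have "A (axis 9 1 + r *s (axis 7 1 + (-1) *s axis 6 1)) *v n = 0 \<and> A (axis 7 1 + r *s axis 8 1) *v n = 0" for r
  proof -
    have "ccross (a0 + s *s a1 + s^2 *s a2) (A (axis 9 1 + r *s (axis 7 1 + (-1) *s axis 6 1)) *v n + s *s (A (axis 7 1 + r *s axis 8 1) *v n)) = 0"
      if "s \<notin> {r}" for s
      using aH[of s r] that unfolding levi_elt_expand lin_simps a_def by simp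
    from nonvanishing_quadratic_parallel_linear[where X = "{r}", OF a_nz[unfolded a_def] a2_nz _ this]
    show ?thesis by simp
  qed
  from this[of 0, unfolded lin_simps] this[of 1, unfolded lin_simps]
  have AH: "A (axis 6 1) *v n = 0" "A (axis 7 1) *v n = 0" "A (axis 8 1) *v n = 0" "A (axis 9 1) *v n = 0"
    by (simp_all add: lin_simps)
  then have AH': "A (levi_elt s r) *v n = 0" for s r by (simp add: levi_elt_expand lin_simps)
  have PH': "P (axis 6 1) *v ccross m n = 0" "P (axis 7 1) *v ccross m n = 0" "P (axis 8 1) *v ccross m n = 0"
    "P (axis 9 1) *v ccross m n = 0" for m
  proof -
    define u6 u7 u8 u9 where u: "u6 = P (axis 6 1) *v ccross m n" "u7 = P (axis 7 1) *v ccross m n"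
      "u8 = P (axis 8 1) *v ccross m n" "u9 = P (axis 9 1) *v ccross m n"
    have e: "u9 + r *s (u7 + (-1) *s u6) + s *s (u7 + r *s u8) = 0" if "s \<noteq> r" for s r
      using PH[OF that, of m] by (simp add: levi_elt_expand lin_simps u)
    have "u9 + u7 - u6 = 0" "u9 - u7 + u6 = 0" "u9 + u7 = 0" "u9 + u6 - u8 = 0"
      using e[of 0 1] e[of 0 "-1"] e[of 1 0] e[of 1 "-1"] by (simp_all add: vec_eq_iff algebra_simps)
    moreover from this(1,2) have "u9 = 0"
      by (simp add: vec_eq_iff) (metis add_diff_cancel_left' add_eq_0_iff diff_add_cancel diff_minus_eq_add eq_neg_iff_add_eq_0 mult_2 mult_eq_0_iff zero_neq_numeral)
    ultimately have "u9 = 0" "u7 = 0" "u6 = 0" "u8 = 0" by auto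
    then show "P (axis 6 1) *v ccross m n = 0" "P (axis 7 1) *v ccross m n = 0" "P (axis 8 1) *v ccross m n = 0"
      "P (axis 9 1) *v ccross m n = 0" by (simp_all add: u)
  qed
  (* Degree -1: the next coefficient for the same points. *)
  have Ah: "A (?h s r) *v n = 0" for s r by (simp add: lin_simps AH')
  have PR: "P (low_cubic r) *v ccross m n = 0" for r m
    using so(3)[of "r - 1" r m, OF Ah] by simp
  have AR: "A (low_cubic r) *v n = 0" for r
  proof (rule parallel_a[of r])
    fix s assume "s \<noteq> r"
    then show "ccross (a s) (A (low_cubic r) *v n) = 0"
      using so(4)[OF Ah, of s _ r] by (intro from_AF) (simp add: lin_simps ccross_smult)
  qed
  have AR': "A (axis 10 1) *v n = 0" "A (axis 11 1) *v n = 0" "A (axis 12 1) *v n = 0" "A (axis 13 1) *v n = 0"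
  proof -
    have "A (axis 13 1) *v n + r *s (A (axis 11 1) *v n) + r^2 *s ((-1) *s (A (axis 12 1) *v n)) + r^3 *s ((-1) *s (A (axis 10 1) *v n)) + r^4 *s 0 = 0" for r
      using AR[of r] unfolding low_cubic_expand lin_simps by simp
    from vec_poly4_zero[of "{}", OF _ this]
    show "A (axis 10 1) *v n = 0" "A (axis 11 1) *v n = 0" "A (axis 12 1) *v n = 0" "A (axis 13 1) *v n = 0" by auto
  qed
  have PR': "P (axis 10 1) *v ccross m n = 0" "P (axis 11 1) *v ccross m n = 0" "P (axis 12 1) *v ccross m n = 0" "P (axis 13 1) *v ccross m n = 0" for m
  proof -
    have "P (axis 13 1) *v ccross m n + r *s (P (axis 11 1) *v ccross m n) + r^2 *s ((-1) *s (P (axis 12 1) *v ccross m n)) + r^3 *s ((-1) *s (P (axis 10 1) *v ccross m n)) + r^4 *s 0 = 0" for r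
      using PR[of r m] unfolding low_cubic_expand lin_simps by simp
    from vec_poly4_zero[of "{}", OF _ this]
    show "P (axis 10 1) *v ccross m n = 0" "P (axis 11 1) *v ccross m n = 0" "P (axis 12 1) *v ccross m n = 0" "P (axis 13 1) *v ccross m n = 0" by auto
  qed
  (* Degree -2. *)
  have h0: "levi_bracket = (-1) *s axis 6 1" by (simp add: vec_eq_iff forall_14 levi_bracket_def axis_def)
  have to: "P bottom_root *v ccross m n = 0" "ccross (A (line_dir s) *v m) (A bottom_root *v n) = 0" for s m
  proof -
    have "(p0 top_root + l * p0 (line_dir s) + t * p0 levi_bracket + l*t* p0 (low_cubic s) - t^2 * p0 bottom_root) *s (- (t^2) *s (P bottom_root *v ccross m n)) =
      ccross (l *s (A (line_dir s) *v m) + t *s (A levi_bracket *v m) + (l*t) *s (A (low_cubic s) *v m) - t^2 *s (A bottom_root *v m)) (- (t^2) *s (A bottom_root *v n))" for l t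
    proof -
      have "A levi_bracket *v n = 0" "P levi_bracket *v ccross m n = 0" unfolding h0 lin_simps using AH PH' by simp_all
      then show ?thesis
        using minors_ccross[OF opposite_point[of l s t], of m n]
        by (simp add: lin_simps base AFn on_lines(1) AR PR)
    qed
    from opposite_expansion[OF base(1) this]
    show "P bottom_root *v ccross m n = 0" "ccross (A (line_dir s) *v m) (A bottom_root *v n) = 0" by auto
  qed
  have AZ: "A bottom_root *v n = 0"
    by (rule parallel_a) (intro from_AF to)
  have An: "A x *v n = 0" for x
  proof -
    have "A x *v n = A (x$1 *s top_root + x$2 *s axis 2 1 + x$3 *s axis 3 1 + x$4 *s axis 4 1 + x$5 *s axis 5 1
   + x$6 *s axis 6 1 + x$7 *s axis 7 1 + x$8 *s axis 8 1 + x$9 *s axis 9 1 + x$10 *s axis 10 1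
   + x$11 *s axis 11 1 + x$12 *s axis 12 1 + x$13 *s axis 13 1 + x$14 *s bottom_root) *v n"
      using vec14_expand[of x] by simp
    moreover have "A (axis 2 1) *v n + s *s (A (axis 3 1) *v n) + s^2 *s (A (axis 4 1) *v n) + s^3 *s (A (axis 5 1) *v n) + s^4 *s 0 = 0" for s
      using AFn[of s] unfolding line_dir_expand lin_simps by simp
    note vec_poly4_zero[of "{}", OF _ this]
    ultimately show ?thesis by (simp add: lin_simps base AH AR' AZ)
  qed
  have Pn: "P x *v ccross m n = 0" for x m
  proof -
    have "P x *v ccross m n = P (x$1 *s top_root + x$2 *s axis 2 1 + x$3 *s axis 3 1 + x$4 *s axis 4 1 + x$5 *s axis 5 1
   + x$6 *s axis 6 1 + x$7 *s axis 7 1 + x$8 *s axis 8 1 + x$9 *s axis 9 1 + x$10 *s axis 10 1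
   + x$11 *s axis 11 1 + x$12 *s axis 12 1 + x$13 *s axis 13 1 + x$14 *s bottom_root) *v ccross m n"
      using vec14_expand[of x] by simp
    then show ?thesis by (simp add: lin_simps base on_line_basis PH' PR' to)
  qed

  (* Complete n to a basis n, m1, m2; the forms that survive are p0, d, A m1, A m2 and P (m1 \<times> m2). *)
  obtain m1 m2 where m12: "cdot n (ccross m1 m2) \<noteq> 0"
  proof -
    obtain k where k: "n $ k \<noteq> 0" using n by (auto simp: vec_eq_iff)
    have "cdot n (ccross (axis 2 1) (axis 3 1)) = n$1" "cdot n (ccross (axis 3 1) (axis 1 1)) = n$2"
      "cdot n (ccross (axis 1 1) (axis 2 1)) = n$3"
      by (simp_all add: vec3_simps axis_def)
    then show ?thesis using k that exhaust_3[of k] by metis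
  qed
  let ?m3 = "ccross m1 m2"
  let ?f = "\<lambda>x. vector [p0 x, d x, (A x *v m1)$1, (A x *v m1)$2, (A x *v m1)$3, (A x *v m2)$1, (A x *v m2)$2, (A x *v m2)$3,
    (P x *v ?m3)$1, (P x *v ?m3)$2, (P x *v ?m3)$3] :: complex^11"
  have "Vector_Spaces.linear (*s) (*s) ?f"
    by (simp add: vec_linear_iff vec_eq_iff forall_11 lin_simps)
  then obtain x where x: "x \<noteq> 0" "?f x = 0" using linear_nontrivial_kernel[of ?f] by auto
  have 0: "p0 x = 0" "d x = 0" "A x *v m1 = 0" "A x *v m2 = 0" "P x *v ?m3 = 0"
    using x(2) unfolding vec_eq_iff by (simp_all add: forall_11 forall_3)
  have "A x = 0"
  proof (rule mat3_zeroI)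
    fix u
    have "cdot n ?m3 *s (A x *v u) = A x *v (cdot n ?m3 *s u)" by (simp add: vec.scale)
    also have "\<dots> = 0" by (simp only: cramer3[of n m1 m2 u]) (simp add: vec.add vec.scale An 0)
    finally show "A x *v u = 0" using m12 by simp
  qed
  moreover have "P x = 0"
  proof (rule mat3_zeroI)
    fix u
    have "cdot n ?m3 *s u = cdot u n *s ?m3 + cdot u m1 *s ccross m2 n + (- cdot u m2) *s ccross m1 n"
      by (simp add: vec3_simps, intro conjI; algebra)
    then have "P x *v (cdot n ?m3 *s u) = 0" by (simp add: vec.add vec.scale vec.diff Pn 0)
    then show "P x *v u = 0" using m12 by (simp add: vec.scale)
  qed
  ultimately have "x = 0" using inj 0 by blast
  then show False using x by blast
qed

lemma inconsistent: False
proof -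
  have "ccross (cubic_curve (A (axis 2 1)) (A (axis 3 1)) (A (axis 4 1)) (A (axis 5 1)) s *v m)
    (cubic_curve (A (axis 2 1)) (A (axis 3 1)) (A (axis 4 1)) (A (axis 5 1)) s *v n) = 0" for s m n
    using on_lines(2)[of s m n] by (simp add: A_line_cubic)
  from rank_one_cubic_factor[OF this A_injective_on_lines]
  obtain a0 a1 a2 b0 b1 where "(\<forall>s m. A (line_dir s) *v m = cdot (b0 + s *s b1) m *s (a0 + s *s a1 + s^2 *s a2))
     \<or> (\<forall>s m. transpose (A (line_dir s)) *v m = cdot (b0 + s *s b1) m *s (a0 + s *s a1 + s^2 *s a2))"
    unfolding A_line_cubic by blast
  then show False
    using no_column_factorisation pluecker_data.no_column_factorisation[OF transpose_data] by blast
qed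

end

section \<open>Trivectors and changes of basis\<close>

text \<open>
  It is convenient to see a trivector as a function of three indices, since the index type of
  \<open>complex^(6^3)\<close> hides the linear action of matrices in each slot.
\<close>

definition coord3 :: "complex^(6^3) \<Rightarrow> 6 \<Rightarrow> 6 \<Rightarrow> 6 \<Rightarrow> complex" where
  "coord3 t a b c = t $ vector [a, b, c]"

definition minor :: "complex^6^3 \<Rightarrow> 6 \<Rightarrow> 6 \<Rightarrow> 6 \<Rightarrow> complex" where
  "minor M a b c = M$1$a * M$2$b * M$3$c + M$1$b * M$2$c * M$3$a + M$1$c * M$2$a * M$3$b
    - M$1$a * M$2$c * M$3$b - M$1$b * M$2$a * M$3$c - M$1$c * M$2$b * M$3$a"

lemma coord3_wedge: "coord3 (wedge M) a b c = minor M a b c"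
  by (simp add: coord3_def wedge_def minor_def det_3 vector_3)

definition base_change :: "complex^6^6 \<Rightarrow> (6 \<Rightarrow> 6 \<Rightarrow> 6 \<Rightarrow> complex) \<Rightarrow> 6 \<Rightarrow> 6 \<Rightarrow> 6 \<Rightarrow> complex" where
  "base_change Q \<tau> i j k = (\<Sum>a\<in>UNIV. \<Sum>b\<in>UNIV. \<Sum>c\<in>UNIV. \<tau> a b c * (Q$a$i * Q$b$j * Q$c$k))"

lemma triple_product_sum:
  "(\<Sum>a\<in>A. x a) * (\<Sum>b\<in>B. y b) * (\<Sum>c\<in>C. z c) = (\<Sum>a\<in>A. \<Sum>b\<in>B. \<Sum>c\<in>C. x a * y b * z c)"
  for x y z :: "_ \<Rightarrow> complex"
proof -
  have "(\<Sum>a\<in>A. x a) * (\<Sum>b\<in>B. y b) * (\<Sum>c\<in>C. z c) = (\<Sum>a\<in>A. x a * ((\<Sum>b\<in>B. y b) * (\<Sum>c\<in>C. z c)))"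
    by (simp only: mult.assoc, rule sum_distrib_right)
  also have "\<dots> = (\<Sum>a\<in>A. \<Sum>b\<in>B. \<Sum>c\<in>C. x a * y b * z c)"
    unfolding sum_product by (simp only: sum_distrib_left mult.assoc)
  finally show ?thesis .
qed

text \<open>
  A minor is multilinear in its three columns, and each column of \<open>M ** Q\<close> is a combination of the
  columns of \<open>M\<close>.
\<close>

lemma base_change_minor: "base_change Q (minor M) i j k = minor (M ** Q) i j k"
proof -
  define m where "m r a l = M$r$a * Q$a$l" for r :: 3 and a l
  have e: "(M ** Q)$r$l = (\<Sum>a\<in>UNIV. m r a l)" for r l
    by (simp add: matrix_matrix_mult_def m_def)
  have "minor (M ** Q) i j k = (\<Sum>a\<in>UNIV. m 1 a i) * (\<Sum>b\<in>UNIV. m 2 b j) * (\<Sum>c\<in>UNIV. m 3 c k)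
    + (\<Sum>a\<in>UNIV. m 3 a i) * (\<Sum>b\<in>UNIV. m 1 b j) * (\<Sum>c\<in>UNIV. m 2 c k)
    + (\<Sum>a\<in>UNIV. m 2 a i) * (\<Sum>b\<in>UNIV. m 3 b j) * (\<Sum>c\<in>UNIV. m 1 c k)
    - (\<Sum>a\<in>UNIV. m 1 a i) * (\<Sum>b\<in>UNIV. m 3 b j) * (\<Sum>c\<in>UNIV. m 2 c k)
    - (\<Sum>a\<in>UNIV. m 2 a i) * (\<Sum>b\<in>UNIV. m 1 b j) * (\<Sum>c\<in>UNIV. m 3 c k)
    - (\<Sum>a\<in>UNIV. m 3 a i) * (\<Sum>b\<in>UNIV. m 2 b j) * (\<Sum>c\<in>UNIV. m 1 c k)"
    by (simp add: minor_def e mult_ac)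
  also have "\<dots> = base_change Q (minor M) i j k"
    unfolding triple_product_sum base_change_def sum.distrib[symmetric] sum_subtractf[symmetric]
    by (intro sum.cong refl) (simp add: minor_def m_def algebra_simps)
  finally show ?thesis ..
qed

lemma base_change_inverse:
  assumes "Q ** R = mat 1"
  shows "base_change R (base_change Q \<tau>) = \<tau>"
proof (intro ext)
  fix i j k
  have QR: "(\<Sum>a\<in>UNIV. Q$x$a * R$a$y) = (if x = y then 1 else 0)" for x y
  proof -
    have "(Q ** R)$x$y = (mat 1 :: complex^6^6)$x$y" using assms by simp
    then show ?thesis by (simp add: matrix_matrix_mult_def mat_def)
  qed
  have "base_change R (base_change Q \<tau>) i j k =
    (\<Sum>a\<in>UNIV. \<Sum>b\<in>UNIV. \<Sum>c\<in>UNIV. \<Sum>x\<in>UNIV. \<Sum>y\<in>UNIV. \<Sum>z\<in>UNIV.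
      \<tau> x y z * ((Q$x$a * R$a$i) * (Q$y$b * R$b$j) * (Q$z$c * R$c$k)))"
    unfolding base_change_def sum_distrib_right by (intro sum.cong refl) simp
  also have "\<dots> = (\<Sum>x\<in>UNIV. \<Sum>y\<in>UNIV. \<Sum>z\<in>UNIV. \<Sum>a\<in>UNIV. \<Sum>b\<in>UNIV. \<Sum>c\<in>UNIV.
      \<tau> x y z * ((Q$x$a * R$a$i) * (Q$y$b * R$b$j) * (Q$z$c * R$c$k)))"
  proof -
    have "(\<Sum>a\<in>UNIV. \<Sum>b\<in>UNIV. \<Sum>c\<in>UNIV. \<Sum>x\<in>UNIV. \<Sum>y\<in>UNIV. \<Sum>z\<in>UNIV. g a b c x y z)
      = (\<Sum>x\<in>UNIV. \<Sum>y\<in>UNIV. \<Sum>z\<in>UNIV. \<Sum>a\<in>UNIV. \<Sum>b\<in>UNIV. \<Sum>c\<in>UNIV. g a b c x y z)"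
      for g :: "6 \<Rightarrow> 6 \<Rightarrow> 6 \<Rightarrow> 6 \<Rightarrow> 6 \<Rightarrow> 6 \<Rightarrow> complex"
      unfolding sum.cartesian_product
      by (rule sum.reindex_bij_witness[of _ "\<lambda>(x,y,z,a,b,c). (a,b,c,x,y,z)" "\<lambda>(a,b,c,x,y,z). (x,y,z,a,b,c)"]) auto
    then show ?thesis .
  qed
  also have "\<dots> = (\<Sum>x\<in>UNIV. \<Sum>y\<in>UNIV. \<Sum>z\<in>UNIV. \<tau> x y z *
      ((\<Sum>a\<in>UNIV. Q$x$a * R$a$i) * (\<Sum>b\<in>UNIV. Q$y$b * R$b$j) * (\<Sum>c\<in>UNIV. Q$z$c * R$c$k)))"
    unfolding triple_product_sum by (simp only: sum_distrib_left)
  also have "\<dots> = \<tau> i j k"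
    unfolding QR by (simp add: if_distrib[where f="\<lambda>x. _ * x"] if_distrib[where f="\<lambda>x. x * _"] cong: if_cong)
  finally show "base_change R (base_change Q \<tau>) i j k = \<tau> i j k" .
qed

definition alternating3 :: "(6 \<Rightarrow> 6 \<Rightarrow> 6 \<Rightarrow> complex) \<Rightarrow> bool" where
  "alternating3 \<tau> \<longleftrightarrow> (\<forall>a b c. \<tau> b a c = - \<tau> a b c \<and> \<tau> a c b = - \<tau> a b c)"

lemma alternating3_trivector:
  assumes "t \<in> trivectors" shows "alternating3 (coord3 t)"
proof -
  have T: "t $ (\<chi> i. p $ \<sigma> i) = of_int (sign \<sigma>) * t $ p" if "\<sigma> permutes (UNIV :: 3 set)" for \<sigma> p
    using assms that by (auto simp: trivectors_def)
  have "coord3 t b a c = - coord3 t a b c" for a b c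
  proof -
    have e: "(\<chi> i. vector [a,b,c] $ (Transposition.transpose 1 2 i)) = (vector [b,a,c] :: 6^3)"
      by (simp add: vec_eq_iff forall_3 Transposition.transpose_def vector_3)
    have "t $ (\<chi> i. vector [a,b,c] $ (Transposition.transpose 1 2 i)) = of_int (sign (Transposition.transpose (1::3) 2)) * t $ vector [a,b,c]"
      by (rule T) (rule permutes_swap_id; simp)
    then show ?thesis unfolding e coord3_def by (simp add: sign_swap_id)
  qed
  moreover have "coord3 t a c b = - coord3 t a b c" for a b c
  proof -
    have e: "(\<chi> i. vector [a,b,c] $ (Transposition.transpose 2 3 i)) = (vector [a,c,b] :: 6^3)"
      by (simp add: vec_eq_iff forall_3 Transposition.transpose_def vector_3)
    have "t $ (\<chi> i. vector [a,b,c] $ (Transposition.transpose 2 3 i)) = of_int (sign (Transposition.transpose (2::3) 3)) * t $ vector [a,b,c]"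
      by (rule T) (rule permutes_swap_id; simp)
    then show ?thesis unfolding e coord3_def by (simp add: sign_swap_id)
  qed
  ultimately show ?thesis unfolding alternating3_def by blast
qed

lemma alternating3_base_change:
  assumes "alternating3 \<tau>" shows "alternating3 (base_change Q \<tau>)"
proof -
  have T: "\<tau> b a c = - \<tau> a b c" "\<tau> a c b = - \<tau> a b c" for a b c
    using assms unfolding alternating3_def by blast+
  have "base_change Q \<tau> j i k = - base_change Q \<tau> i j k" for i j k
  proof -
    have "base_change Q \<tau> j i k = (\<Sum>b\<in>UNIV. \<Sum>a\<in>UNIV. \<Sum>c\<in>UNIV. \<tau> a b c * (Q$a$j * Q$b$i * Q$c$k))"
      unfolding base_change_def by (rule sum.swap)
    also have "\<dots> = (\<Sum>b\<in>UNIV. \<Sum>a\<in>UNIV. \<Sum>c\<in>UNIV. - (\<tau> b a c * (Q$b$i * Q$a$j * Q$c$k)))"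
      by (intro sum.cong refl) (subst T(1), simp add: mult_ac)
    finally show ?thesis by (simp add: base_change_def sum_negf)
  qed
  moreover have "base_change Q \<tau> i k j = - base_change Q \<tau> i j k" for i j k
  proof -
    have "base_change Q \<tau> i k j = (\<Sum>a\<in>UNIV. \<Sum>c\<in>UNIV. \<Sum>b\<in>UNIV. \<tau> a b c * (Q$a$i * Q$b$k * Q$c$j))"
      unfolding base_change_def by (rule sum.cong[OF refl], rule sum.swap)
    also have "\<dots> = (\<Sum>a\<in>UNIV. \<Sum>c\<in>UNIV. \<Sum>b\<in>UNIV. - (\<tau> a c b * (Q$a$i * Q$c$j * Q$b$k)))"
      by (intro sum.cong refl) (subst T(2), simp add: mult_ac)
    finally show ?thesis by (simp add: base_change_def sum_negf)
  qed
  ultimately show ?thesis unfolding alternating3_def by blast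
qed

text \<open>
  The 20 triples listed contain every 3-element set of indices once; they are the triples that occur in
  the components \<open>p0\<close>, \<open>A\<close>, \<open>P\<close>, \<open>d\<close> below, in their cyclic order.
\<close>

lemma alternating3_zeroI:
  assumes alt: "alternating3 \<tau>"
    and z: "\<tau> 1 2 3 = 0" "\<tau> 4 2 3 = 0" "\<tau> 5 2 3 = 0" "\<tau> 6 2 3 = 0" "\<tau> 1 4 3 = 0" "\<tau> 1 5 3 = 0" "\<tau> 1 6 3 = 0"
    "\<tau> 1 2 4 = 0" "\<tau> 1 2 5 = 0" "\<tau> 1 2 6 = 0"
    "\<tau> 1 5 6 = 0" "\<tau> 1 6 4 = 0" "\<tau> 1 4 5 = 0" "\<tau> 2 5 6 = 0" "\<tau> 2 6 4 = 0" "\<tau> 2 4 5 = 0"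
    "\<tau> 3 5 6 = 0" "\<tau> 3 6 4 = 0" "\<tau> 3 4 5 = 0" "\<tau> 4 5 6 = 0"
  shows "\<tau> = (\<lambda>_ _ _. 0)"
proof -
  have T: "\<tau> b a c = - \<tau> a b c" "\<tau> a c b = - \<tau> a b c" for a b c
    using alt unfolding alternating3_def by blast+
  have perm: "\<tau> a c b = 0" "\<tau> b a c = 0" "\<tau> b c a = 0" "\<tau> c a b = 0" "\<tau> c b a = 0" if "\<tau> a b c = 0" for a b c
    using that T by (metis neg_equal_0_iff_equal)+
  have d1: "\<tau> a a c = 0" for a c using T(1)[of a a c] by simp
  have d2: "\<tau> c a a = 0" for a c using T(2)[of c a a] by simp
  have d3: "\<tau> a c a = 0" for a c using T(1)[of a c a] d2[of c a] by simp
  have "\<forall>a b c. \<tau> a b c = 0"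
    by (simp add: forall_6 d1 d2 d3 z z[THEN perm(1)] z[THEN perm(2)] z[THEN perm(3)] z[THEN perm(4)] z[THEN perm(5)])
  then show ?thesis by blast
qed

lemma minor_as_det: "minor M a b c = det (\<chi> i j. M $ i $ (vector [a,b,c] $ j) :: complex^3^3)"
  by (simp add: minor_def det_3 vector_3)

lemma rows_independent:
  assumes "minor M a b c \<noteq> 0" and "(\<Sum>i\<in>UNIV. k i *s M $ i) = 0"
  shows "k i = 0"
proof -
  let ?B = "(\<chi> i j. M $ i $ (vector [a,b,c] $ j)) :: complex^3^3"
  have "invertible ?B" using assms(1) by (simp add: minor_as_det invertible_det_nz)
  then have "\<exists>B'. ?B ** B' = mat 1" using invertible_right_inverse by blast
  then have *: "(\<Sum>i\<in>UNIV. k i *s row i ?B) = 0 \<Longrightarrow> \<forall>i. k i = 0"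
    unfolding matrix_right_invertible_independent_rows by blast
  have "(\<Sum>i\<in>UNIV. k i * M $ i $ l) = 0" for l
    using assms(2) by (simp add: vec_eq_iff)
  then have "(\<Sum>i\<in>UNIV. k i *s row i ?B) = 0"
    by (simp add: vec_eq_iff row_def)
  then show ?thesis using * by blast
qed

text \<open>
  The rows of \<open>M\<close> are extended to a basis, whose vectors are the rows of \<open>R\<close>.  In the coordinates
  given by \<open>Q\<close> the rows of \<open>M\<close> become the first three basis vectors.
\<close>

lemma complete_to_invertible:
  fixes M :: "complex^6^3"
  assumes "\<forall>k. (\<Sum>i\<in>UNIV. k i *s M $ i) = 0 \<longrightarrow> (\<forall>i. k i = 0)"
  shows "\<exists>R Q :: complex^6^6. R ** Q = mat 1 \<and> Q ** R = mat 1 \<and> R $ 1 = M $ 1 \<and> R $ 2 = M $ 2 \<and> R $ 3 = M $ 3"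
proof -
  have indep: "k i = 0" if "(\<Sum>i\<in>UNIV. k i *s M $ i) = 0" for k i using assms that by blast
  let ?S = "range (($) M)"
  have inj: "inj (($) M)"
  proof (rule injI, rule ccontr)
    fix i j assume e: "M $ i = M $ j" and ne: "i \<noteq> j"
    define k :: "3 \<Rightarrow> complex" where "k l = (if l = i then 1 else if l = j then -1 else 0)" for l
    have "(\<Sum>l\<in>UNIV. k l *s M $ l) = (\<Sum>l\<in>{i,j}. k l *s M $ l)"
      by (rule sum.mono_neutral_right) (auto simp: k_def)
    also have "\<dots> = 0" using e ne by (simp add: k_def)
    finally have "k i = 0" by (rule indep)
    then show False by (simp add: k_def)
  qed
  have S: "vec.independent ?S"
  proof (rule vec.independent_if_scalars_zero)
    fix f x assume "(\<Sum>x\<in>?S. f x *s x) = 0" and x: "x \<in> ?S"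
    then have "(\<Sum>i\<in>UNIV. f (M $ i) *s M $ i) = 0"
      by (simp add: sum.reindex[OF inj])
    then have "f (M $ i) = 0" for i using indep[of "\<lambda>i. f (M $ i)"] by blast
    then show "f x = 0" using x by auto
  qed simp
  define B where "B = vec.extend_basis ?S"
  have B: "?S \<subseteq> B" "vec.independent B" "vec.span B = UNIV"
    unfolding B_def using vec.extend_basis_superset[OF S] vec.independent_extend_basis[OF S] vec.span_extend_basis[OF S] by auto
  have finB: "finite B" using B(2) by (rule vec.finiteI_independent)
  have cB: "card B = 6"
    using vec.basis_card_eq_dim[of B UNIV] B by (simp add: vec_dim_card del: vec.dim_UNIV)
  have cS: "card ?S = 3" by (simp add: card_image[OF inj])
  have "card (UNIV - {1,2,3} :: 6 set) = 3" by (subst card_Diff_subset) simp_all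
  moreover have "card (B - ?S) = 3" using cB cS B(1) by (simp add: card_Diff_subset)
  ultimately obtain g where g: "bij_betw g (UNIV - {1,2,3} :: 6 set) (B - ?S)"
    using finite_same_card_bij[of "UNIV - {1,2,3} :: 6 set" "B - ?S"] finB by auto
  define h where "h i = (if i = 1 then M$1 else if i = 2 then M$2 else if i = 3 then M$3 else g i)" for i :: 6
  have hb: "bij_betw h ({1,2,3} \<union> (UNIV - {1,2,3})) (?S \<union> (B - ?S))"
  proof (rule bij_betw_combine)
    have "inj_on h {1,2,3}"
      using injD[OF inj, of 1 2] injD[OF inj, of 1 3] injD[OF inj, of 2 3] by (auto simp: inj_on_def h_def)
    moreover have "h ` {1,2,3} = ?S" unfolding UNIV_3 by (auto simp: h_def)
    ultimately show "bij_betw h {1,2,3} ?S" by (simp add: bij_betw_def)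
    show "bij_betw h (UNIV - {1,2,3}) (B - ?S)"
      using g by (subst bij_betw_cong[of _ h g]) (auto simp: h_def)
  qed auto
  have hb: "bij_betw h UNIV B"
    using hb B(1) by (simp add: Un_absorb1 Un_Diff_cancel)
  define R where "R = (\<chi> i. h i)"
  have "\<forall>c. (\<Sum>i\<in>UNIV. c i *s row i R) = 0 \<longrightarrow> (\<forall>i. c i = 0)"
  proof (intro allI impI)
    fix c i assume c: "(\<Sum>i\<in>UNIV. c i *s row i R) = 0"
    have inv: "inv_into UNIV h (h i) = i" for i using hb by (simp add: bij_betw_def inv_into_f_f)
    have "(\<Sum>v\<in>B. c (inv_into UNIV h v) *s v) = (\<Sum>i\<in>UNIV. c (inv_into UNIV h (h i)) *s h i)"
      using sum.reindex_bij_betw[OF hb, of "\<lambda>v. c (inv_into UNIV h v) *s v"] by simp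
    also have "\<dots> = 0" using c by (simp add: inv R_def row_def vec_lambda_eta)
    finally have "(\<Sum>v\<in>B. c (inv_into UNIV h v) *s v) = 0" .
    then have "c (inv_into UNIV h (h i)) = 0"
      using vec.independentD[OF B(2) finB order_refl, of "\<lambda>v. c (inv_into UNIV h v)" "h i"] hb
      by (auto simp: bij_betw_def)
    then show "c i = 0" by (simp add: inv)
  qed
  then obtain Q where "R ** Q = mat 1" using matrix_right_invertible_independent_rows by blast
  moreover from this have "Q ** R = mat 1" using matrix_left_right_inverse by blast
  moreover have "R $ 1 = M $ 1" "R $ 2 = M $ 2" "R $ 3 = M $ 3" by (simp_all add: R_def h_def)
  ultimately show ?thesis by blast
qed

section \<open>Pluecker relations\<close>

definition left_block :: "complex^6^3 \<Rightarrow> complex^3^3" where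
  "left_block N = (\<chi> i. vector [N$i$1, N$i$2, N$i$3])"

definition right_block :: "complex^6^3 \<Rightarrow> complex^3^3" where
  "right_block N = (\<chi> i. vector [N$i$4, N$i$5, N$i$6])"

text \<open>
  The coordinate in row \<open>i\<close> and column \<open>j\<close> arises from \<open>123\<close> by replacing \<open>i\<close> with \<open>3 + j\<close>.  In
  \<open>quadratic_coords\<close> it is the index \<open>i\<close> followed by \<open>456\<close> without \<open>3 + j\<close>, in the order that makes
  the relation with the cofactors free of signs.
\<close>

definition linear_coords :: "(6 \<Rightarrow> 6 \<Rightarrow> 6 \<Rightarrow> complex) \<Rightarrow> complex^3^3" where
  "linear_coords \<tau> = vector [vector [\<tau> 4 2 3, \<tau> 5 2 3, \<tau> 6 2 3], vector [\<tau> 1 4 3, \<tau> 1 5 3, \<tau> 1 6 3],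
     vector [\<tau> 1 2 4, \<tau> 1 2 5, \<tau> 1 2 6]]"

definition quadratic_coords :: "(6 \<Rightarrow> 6 \<Rightarrow> 6 \<Rightarrow> complex) \<Rightarrow> complex^3^3" where
  "quadratic_coords \<tau> = vector [vector [\<tau> 1 5 6, \<tau> 1 6 4, \<tau> 1 4 5], vector [\<tau> 2 5 6, \<tau> 2 6 4, \<tau> 2 4 5],
     vector [\<tau> 3 5 6, \<tau> 3 6 4, \<tau> 3 4 5]]"

lemma pluecker_relation_quadratic:
  "minor N 1 2 3 * quadratic_coords (minor N) $ i $ j = cofactor3 (linear_coords (minor N)) $ i $ j"
proof -
  have "\<forall>i j. minor N 1 2 3 * quadratic_coords (minor N) $ i $ j = cofactor3 (linear_coords (minor N)) $ i $ j"
    by (simp add: forall_3 quadratic_coords_def linear_coords_def cofactor3_def vector_3, intro conjI;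
        simp add: minor_def, algebra)
  then show ?thesis by blast
qed

lemma det_cofactor3: "det (cofactor3 M) = det M ^ 2"
  by (simp add: det_3 cofactor3_def vector_3, algebra)

text \<open>
  By Cramer's rule \<open>linear_coords\<close> is the adjugate of the left block times the right block, and the
  adjugate has determinant \<open>(det B)\<^sup>2\<close>.
\<close>

lemma pluecker_relation_cubic:
  "minor N 1 2 3 ^ 2 * minor N 4 5 6 = det (linear_coords (minor N))"
proof -
  have "linear_coords (minor N) = transpose (cofactor3 (left_block N)) ** right_block N"
    by (simp add: vec_eq_iff forall_3 linear_coords_def cofactor3_def transpose_def matrix_matrix_mult_def
        sum_3 left_block_def right_block_def vector_3 minor_def, intro conjI; algebra)
  moreover have "det (left_block N) = minor N 1 2 3" "det (right_block N) = minor N 4 5 6"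
    by (simp_all add: det_3 left_block_def right_block_def minor_def vector_3)
  ultimately show ?thesis by (simp add: det_mul det_transpose det_cofactor3)
qed

text \<open>
  Here the point \<open>top_root\<close> is sent to the product of the first three basis vectors, so its
  coordinates other than \<open>123\<close> vanish.
\<close>

lemma no_linear_decomposable_map:
  assumes add: "\<And>x y. \<tau> (x + y) = (\<lambda>a b c. \<tau> x a b c + \<tau> y a b c)"
    and scale: "\<And>k x. \<tau> (k *s x) = (\<lambda>a b c. k * \<tau> x a b c)"
    and inj: "\<And>x. \<tau> x = (\<lambda>_ _ _. 0) \<Longrightarrow> x = 0"
    and alt: "\<And>x. alternating3 (\<tau> x)"
    and dec: "\<And>x. g2_elt x \<in> square_zero_ders \<Longrightarrow> \<exists>N. \<tau> x = minor N"
    and base: "\<tau> top_root = minor N0" "N0 $ 1 = axis 1 1" "N0 $ 2 = axis 2 1" "N0 $ 3 = axis 3 1"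
  shows False
proof -
  have lin: "linear_form (\<lambda>x. \<tau> x a b c)" for a b c
    by (simp add: linear_form_def add scale)
  have m0: "minor N0 a b c = (if a = 1 then 1 else 0) * ((if b = 2 then 1 else 0) * (if c = 3 then 1 else 0) - (if c = 2 then 1 else 0) * (if b = 3 then 1 else 0))
     + (if b = 1 then 1 else 0) * ((if c = 2 then 1 else 0) * (if a = 3 then 1 else 0) - (if a = 2 then 1 else 0) * (if c = 3 then 1 else 0))
     + (if c = 1 then 1 else 0) * ((if a = 2 then 1 else 0) * (if b = 3 then 1 else 0) - (if b = 2 then 1 else 0) * (if a = 3 then 1 else 0))" for a b c
    by (simp add: minor_def base axis_def)
  interpret pluecker_data "\<lambda>x. \<tau> x 1 2 3" "\<lambda>x. \<tau> x 4 5 6" "\<lambda>x. linear_coords (\<tau> x)" "\<lambda>x. quadratic_coords (\<tau> x)"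
  proof
    show "linear_form (\<lambda>x. linear_coords (\<tau> x) $ i $ j)" for i j
      using exhaust_3[of i] exhaust_3[of j] lin by (auto simp: linear_coords_def vector_3)
    show "linear_form (\<lambda>x. quadratic_coords (\<tau> x) $ i $ j)" for i j
      using exhaust_3[of i] exhaust_3[of j] lin by (auto simp: quadratic_coords_def vector_3)
    show "x = 0" if "\<tau> x 1 2 3 = 0" "linear_coords (\<tau> x) = 0" "quadratic_coords (\<tau> x) = 0" "\<tau> x 4 5 6 = 0" for x
      using that by (intro inj alternating3_zeroI[OF alt])
        (simp_all add: vec_eq_iff forall_3 linear_coords_def quadratic_coords_def vector_3)
    show "\<tau> x 1 2 3 * quadratic_coords (\<tau> x) $ i $ j = cofactor3 (linear_coords (\<tau> x)) $ i $ j"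
      "(\<tau> x 1 2 3)^2 * \<tau> x 4 5 6 = det (linear_coords (\<tau> x))" if "g2_elt x \<in> square_zero_ders" for x i j
      using dec[OF that] pluecker_relation_quadratic pluecker_relation_cubic by auto
    show "\<tau> top_root 1 2 3 \<noteq> 0" "linear_coords (\<tau> top_root) = 0" "quadratic_coords (\<tau> top_root) = 0" "\<tau> top_root 4 5 6 = 0"
      by (simp_all add: base(1) linear_coords_def quadratic_coords_def m0 vec_eq_iff forall_3)
  qed (rule lin)+
  show False by (rule inconsistent)
qed

section \<open>Nonexistence of the embedding\<close>

theorem corollary3p11:
  shows "\<not> (\<exists>f. linear_embedding f \<and> (\<forall>p\<in>G2_variety. f ` p \<in> pluecker ` grassmannian_3_6))"
proof
  assume "\<exists>f. linear_embedding f \<and> (\<forall>p\<in>G2_variety. f ` p \<in> pluecker ` grassmannian_3_6)"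
  then obtain f where emb: "linear_embedding f"
    and G: "\<And>p. p \<in> G2_variety \<Longrightarrow> f ` p \<in> pluecker ` grassmannian_3_6" by blast
  have f_add: "f (g2_elt (x + y)) = f (g2_elt x) + f (g2_elt y)" and f_scale: "f (g2_elt (k *s x)) = k *s f (g2_elt x)" for x y k
    using emb g2_elt_in_g2 by (auto simp: linear_embedding_def g2_elt_add g2_elt_scale)
  have f_inj: "x = 0" if "f (g2_elt x) = 0" for x
  proof -
    have "f (g2_elt 0) = f (g2_elt (0 *s 0))" by simp
    then have "f (g2_elt 0) = 0" by (metis f_scale vector_smult_lzero)
    then have "f (g2_elt x) = f (g2_elt 0)" using that by simp
    then show ?thesis using emb g2_elt_in_g2 g2_elt_inj by (meson linear_embedding_def inj_onD)
  qed
  have f_dec: "\<exists>M. f (g2_elt x) = wedge M" if "g2_elt x \<in> square_zero_ders" for x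
  proof -
    have "f (g2_elt x) \<in> f ` matrix_line (g2_elt x)" using matrix_line_self by blast
    then show ?thesis using G[OF square_zero_der_in_G2_variety[OF that]] by (auto simp: pluecker_def)
  qed
  have ext: "t = 0" if "\<And>a b c. coord3 t a b c = 0" for t
  proof -
    have "t $ p = 0" for p
    proof -
      have "p = vector [p$1, p$2, p$3]" by (simp add: vec_eq_iff forall_3)
      then show ?thesis using that[of "p$1" "p$2" "p$3"] by (simp add: coord3_def)
    qed
    then show ?thesis by (simp add: vec_eq_iff)
  qed
  have E: "g2_elt top_root \<in> square_zero_ders" using two_line_point[of 0 0 0 0] by simp
  obtain M where M: "f (g2_elt top_root) = wedge M" using f_dec[OF E] by blast
  have "top_root $ 1 \<noteq> 0" by (simp add: top_root_def)
  then have "top_root \<noteq> 0" by auto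
  then have "wedge M \<noteq> 0" using f_inj M by metis
  then obtain a b c where abc: "minor M a b c \<noteq> 0" using ext coord3_wedge by metis
  have "\<forall>k. (\<Sum>i\<in>UNIV. k i *s M $ i) = 0 \<longrightarrow> (\<forall>i. k i = 0)"
    using rows_independent[OF abc] by blast
  from complete_to_invertible[OF this] obtain R Q :: "complex^6^6" where RQ: "R ** Q = mat 1" "Q ** R = mat 1" "R $ 1 = M $ 1" "R $ 2 = M $ 2" "R $ 3 = M $ 3"
    by blast
  define \<tau> where "\<tau> x = base_change Q (coord3 (f (g2_elt x)))" for x
  have row: "(M ** Q) $ i = (R ** Q) $ j" if "M $ i = R $ j" for i j
    using that by (simp add: vec_eq_iff matrix_matrix_mult_def)
  show False
  proof (rule no_linear_decomposable_map)
    show "\<tau> (x + y) = (\<lambda>a b c. \<tau> x a b c + \<tau> y a b c)" for x y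
      by (simp add: \<tau>_def f_add base_change_def coord3_def fun_eq_iff sum.distrib[symmetric] algebra_simps)
    show "\<tau> (k *s x) = (\<lambda>a b c. k * \<tau> x a b c)" for k x
      by (simp add: \<tau>_def f_scale base_change_def coord3_def fun_eq_iff sum_distrib_left mult.assoc)
    show "x = 0" if "\<tau> x = (\<lambda>_ _ _. 0)" for x
    proof -
      have "coord3 (f (g2_elt x)) = base_change R (\<lambda>_ _ _. 0)"
        using base_change_inverse[OF RQ(2)] that \<tau>_def by metis
      then have "coord3 (f (g2_elt x)) a b c = 0" for a b c by (simp add: base_change_def)
      then show ?thesis using ext f_inj by blast
    qed
    have "f (g2_elt x) \<in> trivectors" for x using emb g2_elt_in_g2 by (auto simp: linear_embedding_def)
    then show "alternating3 (\<tau> x)" for x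
      unfolding \<tau>_def by (intro alternating3_base_change alternating3_trivector)
    have minor: "\<tau> x = minor (N ** Q)" if "f (g2_elt x) = wedge N" for x N
      using that by (simp add: \<tau>_def fun_eq_iff coord3_wedge[abs_def] base_change_minor)
    show "\<exists>N. \<tau> x = minor N" if "g2_elt x \<in> square_zero_ders" for x
      using f_dec[OF that] minor by blast
    show "\<tau> top_root = minor (M ** Q)" by (rule minor[OF M])
    show "(M ** Q) $ 1 = axis 1 1" "(M ** Q) $ 2 = axis 2 1" "(M ** Q) $ 3 = axis 3 1"
      using row[OF RQ(3)[symmetric]] row[OF RQ(4)[symmetric]] row[OF RQ(5)[symmetric]]
      by (simp_all add: RQ(1) mat_def axis_def vec_eq_iff)
  qed
qed

end
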